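(* Let $k$ be a field, let $0\le \ell<n$ be integers, let $P(z)$ be an admissible Hilbert polynomial for homogeneous ideals of $S^{(\ell,n)}=k[x_\ell,\dots,x_n]$, and let $s$ be a positive integer that is greater than or equal to the Gotzmann number of $P(z)$. Then the algorithm $\mathrm{QuasiStable}(\ell,n,P(z),s)$ returns the set of all saturated quasi-stable ideals of $S^{(\ell,n)}$ having Hilbert polynomial $P(z)$.
   Context: Ring and terms. $S^{(\ell,n)}=k[x_\ell,\dots,x_n]$ is standard graded, with variables ordered $x_\ell<\cdots<x_n$. A term is a power product $x^\alpha=x_\ell^{\alpha_\ell}\cdots x_n^{\alpha_n}$; $\mathbb T(\ell)$ is the set of terms in $x_\ell,\dots,x_n$. For a term $x^\alpha\ne 1$, $\min(x^\alpha)$ is the smallest variable dividing $x^\alpha$. For a homogeneous ideal $I$, $I_t$ is its degree-$t$ component and $I_{\ge t}=\bigoplus_{i\ge t}I_i$. Hilbert polynomial. The Hilbert polynomial of a homogeneous ideal $I\subseteq S^{(\ell,n)}$ is the polynomial $P(z)$ with $\dim_k(S^{(\ell,n)}_t/I_t)=P(t)$ for all $t\gg0$. $P(z)$ is admissible if it is the Hilbert polynomial of some homogeneous ideal of the ring. $\Delta P(z)=P(z)-P(z-1)$. The Gotzmann number of an admissible $P(z)$ is the integer $r$ in the unique expression $P(z)=\binom{z+a_1}{a_1}+\binom{z+a_2-1}{a_2}+\cdots+\binom{z+a_r-(r-1)}{a_r}$ with $a_1\ge a_2\ge\cdots\ge a_r\ge 0$ ($r=0$ if $P=0$). Saturation.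 $I^{\mathrm{sat}}=(I:(x_\ell,\dots,x_n)^\infty)$; $I$ is saturated if $I=I^{\mathrm{sat}}$. Quasi-stable and stable. A monomial ideal $J$ is quasi-stable if for every term $x^\alpha\ne1$ in $J$ and every $x_j>\min(x^\alpha)$ there is $t\ge0$ with $x_j^t x^\alpha/\min(x^\alpha)\in J$. It is stable if $x_jx^\alpha/\min(x^\alpha)\in J$ for all such $x^\alpha,x_j$. St-minimal. If $J_{\ge s}$ is a stable ideal, a term $x^\alpha\in J_s$ is St-minimal if $x_jx^\beta/\min(x^\beta)\ne x^\alpha$ for every term $x^\beta\in J_{\ge s}$ and every $x_j>\min(x^\beta)$. Auxiliary procedure $\mathrm{Remove}(I,\ell,n,s,q)$, for a quasi-stable ideal $I\subseteq S^{(\ell,n)}$ (given by a set of generating terms) and $q\ge0$: (1) if $q=0$, return $\{I^{\mathrm{sat}}\}$; (2) if $q>0$, let $M$ be the set of St-minimal terms $x^\alpha\in I_s$ with $\min(x^\alpha)=x_\ell$, and return $\bigcup_{x^\alpha\in M}\mathrm{Remove}(I^{(\alpha)},\ell,n,s,q-1)$, where $I^{(\alpha)}$ is the ideal generated by $(I_s\cap\mathbb T(\ell))\setminus\{x^\alpha\}$. Algorithm $\mathrm{QuasiStable}(\ell,n,P(z),s)$: (1) if $P(z)=0$, return $\{(1)\}$; (2) otherwise set $E:=\mathrm{QuasiStable}(\ell+1,n,\Delta P(z),s)$ (a set of ideals of $S^{(\ell+1,n)}$) and $F:=\emptyset$; for each $J\in E$ let $I:=J\cdot k[x_\ell,\dots,x_n]$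 and $q:=P(s)-\binom{n-\ell+s}{s}+\dim_k I_s$, and if $q\ge0$ replace $F$ by $F\cup\mathrm{Remove}(I,\ell,n,s,q)$; finally return $F$. In recursive calls the first index may exceed $n-1$; one sets $S^{(n,n)}=k[x_n]$ and $S^{(n+1,n)}=k$. *)

theory Defs
  imports
    "HOL-Algebra.Ideal_Product"
    "HOL-Library.Poly_Mapping"
    "HOL-Computational_Algebra.Polynomial"
begin

section \<open>Polynomial rings in the variables with indices from l to n\<close>

text \<open>
  A term \<open>x\<^sup>\<alpha>\<close> is represented by its exponent vector, a finitely supported function from variable
  indices to exponents; the order of the variables is the order of their indices. In particular
  \<open>1\<close> is the exponent vector \<open>0\<close>, and multiplication of terms is addition of exponent vectors.
\<close>

type_synonym pterm = "nat \<Rightarrow>\<^sub>0 nat"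

type_synonym 'k mpoly = "(nat \<Rightarrow>\<^sub>0 nat) \<Rightarrow>\<^sub>0 'k"

definition terms :: "nat \<Rightarrow> nat \<Rightarrow> pterm set" where
  "terms l n = {\<alpha>. Poly_Mapping.keys \<alpha> \<subseteq> {l..n}}"

definition tdeg :: "pterm \<Rightarrow> nat" where
  "tdeg \<alpha> = (\<Sum>i\<in>Poly_Mapping.keys \<alpha>. Poly_Mapping.lookup \<alpha> i)"

text \<open>Index of the smallest variable dividing a term; meaningful only for \<open>\<alpha> \<noteq> 0\<close>.\<close>

definition min_var :: "pterm \<Rightarrow> nat" where
  "min_var \<alpha> = Min (Poly_Mapping.keys \<alpha>)"

definition div_min :: "pterm \<Rightarrow> pterm" where
  "div_min \<alpha> = \<alpha> - Poly_Mapping.single (min_var \<alpha>) 1"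

definition monom_of :: "pterm \<Rightarrow> 'k::field mpoly" where
  "monom_of \<alpha> = Poly_Mapping.single \<alpha> 1"

text \<open>
  The ring \<open>k[x\<^sub>l, \<dots>, x\<^sub>n]\<close>, as a subring of the polynomial ring in countably many variables.
  For \<open>l = n + 1\<close> it consists of the constants.
\<close>

definition mpoly_ring :: "nat \<Rightarrow> nat \<Rightarrow> 'k::field mpoly ring" where
  "mpoly_ring l n =
     \<lparr>carrier = {f. Poly_Mapping.keys f \<subseteq> terms l n}, monoid.mult = (*), one = 1, zero = 0, add = (+)\<rparr>"

definition pscale :: "'k::field \<Rightarrow> 'k mpoly \<Rightarrow> 'k mpoly" where
  "pscale c f = Poly_Mapping.single 0 c * f"

global_interpretation poly_vs: vector_space "pscale :: 'k::field \<Rightarrow> 'k mpoly \<Rightarrow> 'k mpoly"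
  by unfold_locales
    (simp_all add: pscale_def algebra_simps single_add mult_single flip: mult.assoc)


section \<open>Gradings, homogeneous ideals and Hilbert polynomials\<close>

definition hom_component :: "nat \<Rightarrow> 'k::field mpoly \<Rightarrow> 'k mpoly" where
  "hom_component t f = Poly_Mapping.mapp (\<lambda>\<alpha> c. if tdeg \<alpha> = t then c else 0) f"

definition homogeneous_ideal :: "nat \<Rightarrow> nat \<Rightarrow> 'k::field mpoly set \<Rightarrow> bool" where
  "homogeneous_ideal l n I \<longleftrightarrow> ideal I (mpoly_ring l n) \<and> (\<forall>f\<in>I. \<forall>t. hom_component t f \<in> I)"

definition graded_part :: "'k::field mpoly set \<Rightarrow> nat \<Rightarrow> 'k mpoly set" where
  "graded_part I t = {f \<in> I. \<forall>\<alpha>\<in>Poly_Mapping.keys f. tdeg \<alpha> = t}"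

text \<open>The (direct) sum of the graded parts of degree at least \<open>t\<close>.\<close>

definition truncation :: "'k::field mpoly set \<Rightarrow> nat \<Rightarrow> 'k mpoly set" where
  "truncation I t = poly_vs.span (\<Union>i\<in>{t..}. graded_part I i)"

text \<open>
  Since \<open>S\<^sub>t\<close> is finite dimensional, the dimension of \<open>S\<^sub>t / I\<^sub>t\<close> is the difference of the dimensions.
\<close>

definition has_hilbert_polynomial :: "nat \<Rightarrow> nat \<Rightarrow> 'k::field mpoly set \<Rightarrow> rat poly \<Rightarrow> bool" where
  "has_hilbert_polynomial l n I P \<longleftrightarrow>
     (\<forall>\<^sub>F t in sequentially.
        rat_of_nat (poly_vs.dim (graded_part (carrier (mpoly_ring l n) :: 'k mpoly set) t))
          - rat_of_nat (poly_vs.dim (graded_part I t)) = poly P (rat_of_nat t))"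

definition admissible :: "'k::field itself \<Rightarrow> nat \<Rightarrow> nat \<Rightarrow> rat poly \<Rightarrow> bool" where
  "admissible k l n P \<longleftrightarrow>
     (\<exists>I :: 'k mpoly set. homogeneous_ideal l n I \<and> has_hilbert_polynomial l n I P)"

definition backward_diff :: "rat poly \<Rightarrow> rat poly" where
  "backward_diff P = P - pcompose P [:-1, 1:]"

text \<open>
  \<open>is_gotzmann_number P r\<close>: \<open>P(z) = \<Sum>\<^sub>i binom (z + a\<^sub>i - (i - 1)) a\<^sub>i\<close>, \<open>i = 1, \<dots>, r\<close>, for some
  \<open>a\<^sub>1 \<ge> \<dots> \<ge> a\<^sub>r \<ge> 0\<close>. The list positions are counted from \<open>0\<close>, so that \<open>as ! i\<close> is \<open>a\<^sub>i\<^sub>+\<^sub>1\<close>.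
  Every admissible polynomial has exactly one such expression.
\<close>

definition is_gotzmann_number :: "rat poly \<Rightarrow> nat \<Rightarrow> bool" where
  "is_gotzmann_number P r \<longleftrightarrow>
     (\<exists>as :: nat list. length as = r \<and> sorted_wrt (\<ge>) as \<and>
        (\<forall>z. poly P z = (\<Sum>i<r. (z + rat_of_nat (as ! i) - rat_of_nat i) gchoose (as ! i))))"


section \<open>Saturation\<close>

definition irrelevant_ideal :: "nat \<Rightarrow> nat \<Rightarrow> 'k::field mpoly set" where
  "irrelevant_ideal l n =
     Idl\<^bsub>mpoly_ring l n\<^esub> ((\<lambda>i. monom_of (Poly_Mapping.single i 1)) ` {l..n})"

primrec ideal_power :: "nat \<Rightarrow> nat \<Rightarrow> 'k::field mpoly set \<Rightarrow> nat \<Rightarrow> 'k mpoly set" where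
  "ideal_power l n I 0 = carrier (mpoly_ring l n)"
| "ideal_power l n I (Suc t) = ideal_prod (mpoly_ring l n) I (ideal_power l n I t)"

definition ideal_colon ::
  "nat \<Rightarrow> nat \<Rightarrow> 'k::field mpoly set \<Rightarrow> 'k mpoly set \<Rightarrow> 'k mpoly set" where
  "ideal_colon l n I J = {f \<in> carrier (mpoly_ring l n). \<forall>g\<in>J. f * g \<in> I}"

definition saturation :: "nat \<Rightarrow> nat \<Rightarrow> 'k::field mpoly set \<Rightarrow> 'k mpoly set" where
  "saturation l n I = (\<Union>t. ideal_colon l n I (ideal_power l n (irrelevant_ideal l n) t))"

definition saturated :: "nat \<Rightarrow> nat \<Rightarrow> 'k::field mpoly set \<Rightarrow> bool" where
  "saturated l n I \<longleftrightarrow> ideal I (mpoly_ring l n) \<and> saturation l n I = I"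


section \<open>Quasi-stable ideals and St-minimal terms\<close>

definition monomial_ideal :: "nat \<Rightarrow> nat \<Rightarrow> 'k::field mpoly set \<Rightarrow> bool" where
  "monomial_ideal l n J \<longleftrightarrow> (\<exists>G \<subseteq> terms l n. J = Idl\<^bsub>mpoly_ring l n\<^esub> (monom_of ` G))"

definition quasi_stable :: "nat \<Rightarrow> nat \<Rightarrow> 'k::field mpoly set \<Rightarrow> bool" where
  "quasi_stable l n J \<longleftrightarrow> monomial_ideal l n J \<and>
     (\<forall>\<alpha>\<in>terms l n. \<alpha> \<noteq> 0 \<longrightarrow> monom_of \<alpha> \<in> J \<longrightarrow>
        (\<forall>j. min_var \<alpha> < j \<and> j \<le> n \<longrightarrow>
           (\<exists>t. monom_of (Poly_Mapping.single j t + div_min \<alpha>) \<in> J)))"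

text \<open>The notion is intended for ideals \<open>J\<close> whose truncation in degree \<open>s\<close> is stable.\<close>

definition st_minimal :: "nat \<Rightarrow> nat \<Rightarrow> 'k::field mpoly set \<Rightarrow> nat \<Rightarrow> pterm \<Rightarrow> bool" where
  "st_minimal l n J s \<alpha> \<longleftrightarrow>
     \<alpha> \<in> terms l n \<and> monom_of \<alpha> \<in> graded_part J s \<and>
     (\<forall>\<beta>\<in>terms l n. \<beta> \<noteq> 0 \<longrightarrow> monom_of \<beta> \<in> truncation J s \<longrightarrow>
        (\<forall>j. min_var \<beta> < j \<and> j \<le> n \<longrightarrow> Poly_Mapping.single j 1 + div_min \<beta> \<noteq> \<alpha>))"


section \<open>The algorithm\<close>

fun Remove :: "'k::field mpoly set \<Rightarrow> nat \<Rightarrow> nat \<Rightarrow> nat \<Rightarrow> nat \<Rightarrow> 'k mpoly set set" where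
  "Remove I l n s 0 = {saturation l n I}"
| "Remove I l n s (Suc q) =
     (\<Union>\<alpha> \<in> {\<alpha>. st_minimal l n I s \<alpha> \<and> \<alpha> \<noteq> 0 \<and> min_var \<alpha> = l}.
        Remove (Idl\<^bsub>mpoly_ring l n\<^esub> (monom_of ` ({\<beta> \<in> terms l n. monom_of \<beta> \<in> graded_part I s} - {\<alpha>})))
          l n s q)"

text \<open>
  The number \<open>n - l + s\<close> is written \<open>n + s - l\<close>, which is the same whenever \<open>l \<le> n + 1\<close> and
  \<open>s > 0\<close>, without truncation in the case \<open>l = n + 1\<close>. If \<open>P\<close> is integer-valued, as every
  admissible polynomial is, then \<open>q\<close> is an integer.
\<close>

function QuasiStable :: "nat \<Rightarrow> nat \<Rightarrow> rat poly \<Rightarrow> nat \<Rightarrow> 'k::field mpoly set set" where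
  "QuasiStable l n P s =
     (if P = 0 then {Idl\<^bsub>mpoly_ring l n\<^esub> {1}}
      else \<Union>J \<in> QuasiStable (Suc l) n (backward_diff P) s.
        let I = Idl\<^bsub>mpoly_ring l n\<^esub> J;
            q = poly P (rat_of_nat s) - rat_of_nat ((n + s - l) choose s)
                  + rat_of_nat (poly_vs.dim (graded_part I s))
        in if q \<ge> 0 then Remove I l n s (nat \<lfloor>q\<rfloor>) else {})"
  by pat_completeness auto

lemma backward_diff_smaller:
  assumes "P \<noteq> 0" and "backward_diff P \<noteq> 0"
  shows "Polynomial.degree (backward_diff P) < Polynomial.degree P"
proof -
  let ?Q = "pcompose P [:-1, 1:]"
  have deg: "Polynomial.degree ?Q = Polynomial.degree P"
    by (simp add: degree_pcompose)
  have "Polynomial.lead_coeff ?Q = Polynomial.lead_coeff P"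
    by (subst lead_coeff_comp) simp_all
  then have lead: "Polynomial.coeff (backward_diff P) (Polynomial.degree P) = 0"
    by (simp add: backward_diff_def deg)
  have le: "Polynomial.degree (backward_diff P) \<le> Polynomial.degree P"
    unfolding backward_diff_def using degree_diff_le_max[of P ?Q] deg by simp
  have "Polynomial.degree (backward_diff P) \<noteq> Polynomial.degree P"
    using lead assms(2) by (metis leading_coeff_0_iff)
  with le show ?thesis by simp
qed

termination
  by (relation "measure (\<lambda>(l, n, P, s). if P = 0 then 0 else Suc (Polynomial.degree P))")
    (auto simp: backward_diff_smaller)

declare QuasiStable.simps [simp del]

end

theory Submission
  imports Defs
begin

text \<open>
  A monomial ideal is determined by the set \<open>M\<close> of its terms. If \<open>M\<close> is quasi-stable and saturated,
  it is the cylinder over its slice \<open>N\<close> without \<open>x\<^sub>l\<close>; let \<open>N'\<close> be the saturation of \<open>N\<close>. The set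
  \<open>N' - N\<close> is finite, and its number of elements plus the excess of the Hilbert function of \<open>N'\<close> over
  the lexicographic lower bound is the number of zeros among the Gotzmann exponents \<open>a\<^sub>i\<close>.
  If \<open>N'\<close> is stable from degree \<open>r\<close> on, dividing an element of \<open>N' - N\<close> repeatedly by its smallest
  variable stays in \<open>N' - N\<close> down to degree \<open>r\<close>, so the elements of \<open>N' - N\<close> have bounded degree.
  By induction on the number of variables this gives Gotzmann's regularity bound: \<open>M\<close> is stable, and its
  Hilbert function equals its Hilbert polynomial, from the Gotzmann number on.

  Hence in degree \<open>s\<close> all ideals in question are stable, and \<open>M\<close> arises from the cylinder over \<open>N'\<close> by
  deleting exactly \<open>q\<close> terms divisible by \<open>x\<^sub>l\<close>. Deleting a St-minimal term preserves stability, and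
  as long as terms remain to be deleted, one of them is St-minimal.
\<close>

section \<open>Terms and quasi-stable sets of terms\<close>

text \<open>The count of zeros bounds \<open>N' - N\<close> only if the excess is nonnegative. The
  lexicographic lower bound must therefore be carried through the same induction, in all degrees.
  Let r be the number of positive exponents and m the number of zeros. A term of degree d >= r in
  \<open>N' - N\<close> brings with it terms of every degree from r to d, so d - r + 1 <= m, that is
  d < r + m; and r + m is the Gotzmann number. The induction itself is possible because the positive
  exponents, each lowered by one, are the exponents of the backward difference of P, which belongs
  to the slice. For the algorithm the obstacle is that the deletions control the Hilbert function in
  degree s alone. This suffices because consecutive differences of the Hilbert function of a
  saturated quasi-stable ideal form the Hilbert function of its slice, and the slice is known from
  degree s on by the recursion. Terms of degree below s never have to be followed, since a
  saturation is determined by high degrees.\<close>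

abbreviation expo :: "pterm \<Rightarrow> nat \<Rightarrow> nat" where
  "expo \<equiv> Poly_Mapping.lookup"

abbreviation xpow :: "nat \<Rightarrow> nat \<Rightarrow> pterm" where
  "xpow \<equiv> Poly_Mapping.single"

lemma terms_iff: "\<alpha> \<in> terms l n \<longleftrightarrow> (\<forall>i. i < l \<or> n < i \<longrightarrow> expo \<alpha> i = 0)"
proof -
  have "\<alpha> \<in> terms l n \<longleftrightarrow> (\<forall>i. expo \<alpha> i \<noteq> 0 \<longrightarrow> l \<le> i \<and> i \<le> n)"
    by (simp add: terms_def in_keys_iff subset_iff)
  then show ?thesis by (metis linorder_not_le)
qed

lemma keys_terms: "\<alpha> \<in> terms l n \<Longrightarrow> i \<in> Poly_Mapping.keys \<alpha> \<Longrightarrow> l \<le> i \<and> i \<le> n"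
  by (auto simp: terms_def)

lemma zero_terms [simp]: "0 \<in> terms l n"
  by (simp add: terms_def)

lemma add_terms: "\<alpha> \<in> terms l n \<Longrightarrow> \<beta> \<in> terms l n \<Longrightarrow> \<alpha> + \<beta> \<in> terms l n"
  by (simp add: terms_iff lookup_add)

lemma xpow_terms: "l \<le> j \<Longrightarrow> j \<le> n \<Longrightarrow> xpow j t \<in> terms l n"
  by (auto simp: terms_iff lookup_single when_def)

lemma terms_mono: "\<alpha> \<in> terms (Suc l) n \<Longrightarrow> \<alpha> \<in> terms l n"
  by (simp add: terms_iff)

lemma terms_Suc_iff: "\<alpha> \<in> terms (Suc l) n \<longleftrightarrow> \<alpha> \<in> terms l n \<and> expo \<alpha> l = 0"
  by (auto simp: terms_iff less_Suc_eq)

lemma terms_trivial: "n < l \<Longrightarrow> terms l n = {0}"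
  by (auto simp: terms_iff intro!: poly_mapping_eqI) (metis le_less_linear order.strict_trans1)

lemma tdeg_superset:
  assumes "finite A" "Poly_Mapping.keys \<alpha> \<subseteq> A"
  shows "tdeg \<alpha> = (\<Sum>i\<in>A. expo \<alpha> i)"
  unfolding tdeg_def by (rule sum.mono_neutral_left) (use assms in \<open>auto simp: in_keys_iff\<close>)

lemma tdeg_zero [simp]: "tdeg 0 = 0"
  by (simp add: tdeg_def)

lemma tdeg_xpow [simp]: "tdeg (xpow j t) = t"
  by (cases "t = 0") (simp_all add: tdeg_def)

lemma tdeg_add [simp]: "tdeg (\<alpha> + \<beta>) = tdeg \<alpha> + tdeg \<beta>"
proof -
  let ?A = "Poly_Mapping.keys \<alpha> \<union> Poly_Mapping.keys \<beta>"
  have "tdeg (\<alpha> + \<beta>) = (\<Sum>i\<in>?A. expo (\<alpha> + \<beta>) i)"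
    by (rule tdeg_superset) (simp_all add: Poly_Mapping.keys_add)
  also have "\<dots> = (\<Sum>i\<in>?A. expo \<alpha> i) + (\<Sum>i\<in>?A. expo \<beta> i)"
    by (simp add: lookup_add sum.distrib)
  finally show ?thesis
    by (simp flip: tdeg_superset)
qed

lemma expo_le_tdeg: "expo \<alpha> i \<le> tdeg \<alpha>"
proof (cases "i \<in> Poly_Mapping.keys \<alpha>")
  case True
  then show ?thesis unfolding tdeg_def by (intro member_le_sum) auto
qed (simp add: in_keys_iff)

lemma tdeg_eq_0_iff [simp]: "tdeg \<alpha> = 0 \<longleftrightarrow> \<alpha> = 0"
proof
  assume "tdeg \<alpha> = 0"
  then have "expo \<alpha> i = 0" for i using expo_le_tdeg[of \<alpha> i] by simp
  then show "\<alpha> = 0" by (intro poly_mapping_eqI) simp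
qed simp

lemma finite_bounded_terms: "finite {\<alpha> \<in> terms l n. \<forall>i. expo \<alpha> i \<le> d}"
proof -
  have "finite {f :: nat \<Rightarrow> nat. \<forall>i. (i \<in> {l..n} \<longrightarrow> f i \<in> {..d}) \<and> (i \<notin> {l..n} \<longrightarrow> f i = 0)}"
    by (rule finite_set_of_finite_funs) auto
  then have "finite (expo ` {\<alpha> \<in> terms l n. \<forall>i. expo \<alpha> i \<le> d})"
    by (rule finite_subset[rotated]) (auto simp: terms_iff)
  then show ?thesis
    by (rule finite_imageD) (simp add: inj_on_def Poly_Mapping.lookup_inject)
qed

lemma finite_terms_tdeg_le: "finite {\<alpha> \<in> terms l n. tdeg \<alpha> \<le> d}"
  by (rule finite_subset[OF _ finite_bounded_terms[of l n d]])
    (auto intro: order.trans[OF expo_le_tdeg])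

lemma finite_terms_tdeg: "finite {\<alpha> \<in> terms l n. tdeg \<alpha> = d}"
  by (rule finite_subset[OF _ finite_terms_tdeg_le[of l n d]]) auto

lemma expo_sub_xpow: "xpow j 1 + (\<alpha> - xpow j 1) = \<alpha>" if "expo \<alpha> j \<noteq> 0"
  using that by (intro poly_mapping_eqI) (auto simp: lookup_add lookup_minus lookup_single when_def)

lemma min_var_in_keys: "\<alpha> \<noteq> 0 \<Longrightarrow> min_var \<alpha> \<in> Poly_Mapping.keys \<alpha>"
  unfolding min_var_def by (intro Min_in) auto

lemma min_var_le: "expo \<alpha> i \<noteq> 0 \<Longrightarrow> min_var \<alpha> \<le> i"
  unfolding min_var_def by (intro Min_le) (auto simp: in_keys_iff)

lemma expo_min_var: "\<alpha> \<noteq> 0 \<Longrightarrow> expo \<alpha> (min_var \<alpha>) \<noteq> 0"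
  by (metis in_keys_iff min_var_in_keys)

lemma min_var_eqI: "expo \<alpha> m \<noteq> 0 \<Longrightarrow> (\<And>i. expo \<alpha> i \<noteq> 0 \<Longrightarrow> m \<le> i) \<Longrightarrow> min_var \<alpha> = m"
  unfolding min_var_def by (intro Min_eqI) (auto simp: in_keys_iff)

lemma min_var_terms: "\<alpha> \<in> terms l n \<Longrightarrow> \<alpha> \<noteq> 0 \<Longrightarrow> l \<le> min_var \<alpha> \<and> min_var \<alpha> \<le> n"
  using keys_terms min_var_in_keys by blast

lemma min_var_eq_low: "\<alpha> \<in> terms l n \<Longrightarrow> expo \<alpha> l \<noteq> 0 \<Longrightarrow> min_var \<alpha> = l"
  by (rule min_var_eqI) (auto simp: terms_iff not_less[symmetric])

lemma div_min_add: "\<alpha> \<noteq> 0 \<Longrightarrow> xpow (min_var \<alpha>) 1 + div_min \<alpha> = \<alpha>"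
  unfolding div_min_def by (rule expo_sub_xpow) (rule expo_min_var)

lemma div_min_eqI:
  assumes "min_var \<alpha> = m" "\<alpha> = xpow m 1 + \<beta>"
  shows "div_min \<alpha> = \<beta>"
  using assms by (simp add: div_min_def)

lemma div_min_terms: "\<alpha> \<in> terms l n \<Longrightarrow> div_min \<alpha> \<in> terms l n"
  by (auto simp: terms_iff div_min_def lookup_minus)

lemma tdeg_div_min: "\<alpha> \<noteq> 0 \<Longrightarrow> Suc (tdeg (div_min \<alpha>)) = tdeg \<alpha>"
  using tdeg_add[of "xpow (min_var \<alpha>) 1" "div_min \<alpha>"]
  by (simp add: div_min_add del: One_nat_def)

lemma min_var_xpow_add:
  "\<alpha> \<noteq> 0 \<Longrightarrow> min_var \<alpha> \<le> j \<Longrightarrow> min_var (xpow j t + \<alpha>) = min_var \<alpha>"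
  by (rule min_var_eqI)
    (auto simp: lookup_add expo_min_var lookup_single when_def min_var_le split: if_splits)

lemma div_min_xpow_add:
  "\<alpha> \<noteq> 0 \<Longrightarrow> min_var \<alpha> \<le> j \<Longrightarrow> div_min (xpow j t + \<alpha>) = xpow j t + div_min \<alpha>"
  by (rule div_min_eqI[OF min_var_xpow_add])
    (simp_all add: div_min_add add.left_commute del: One_nat_def)

section \<open>Monomial ideals as sets of terms: quasi-stability, stability, saturation\<close>

definition term_ideal :: "nat \<Rightarrow> nat \<Rightarrow> pterm set \<Rightarrow> bool" where
  "term_ideal l n M \<longleftrightarrow> M \<subseteq> terms l n \<and> (\<forall>\<alpha>\<in>M. \<forall>\<delta>\<in>terms l n. \<alpha> + \<delta> \<in> M)"

definition qstable :: "nat \<Rightarrow> nat \<Rightarrow> pterm set \<Rightarrow> bool" where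
  "qstable l n M \<longleftrightarrow> term_ideal l n M \<and>
     (\<forall>\<alpha>\<in>M. \<alpha> \<noteq> 0 \<longrightarrow> (\<forall>j. min_var \<alpha> < j \<and> j \<le> n \<longrightarrow> (\<exists>t. xpow j t + div_min \<alpha> \<in> M)))"

text \<open>For a \<open>term_ideal\<close> this says that the truncation of \<open>M\<close> in
  degree \<open>s\<close> is stable and generated in degree \<open>s\<close>; see
  \<open>stable_from_exchange\<close> and \<open>stable_from_generated\<close>. As one closure
  property under division by the smallest variable it permits descent in the degree.\<close>

definition stable_from :: "nat \<Rightarrow> pterm set \<Rightarrow> bool" where
  "stable_from s M \<longleftrightarrow> (\<forall>\<alpha>\<in>M. s < tdeg \<alpha> \<longrightarrow> div_min \<alpha> \<in> M)"

text \<open>Only pure powers are tested, each with its own exponent; \<open>saturation_mspan\<close>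
  shows that this gives the saturation by the irrelevant ideal. For \<open>l > n\<close> the
  condition is vacuous and the saturation is the whole ring, which decides the cases without
  variables.\<close>

definition term_sat :: "nat \<Rightarrow> nat \<Rightarrow> pterm set \<Rightarrow> pterm set" where
  "term_sat l n M = {\<alpha> \<in> terms l n. \<forall>j\<in>{l..n}. \<exists>t. \<alpha> + xpow j t \<in> M}"

lemma term_ideal_subset: "term_ideal l n M \<Longrightarrow> \<alpha> \<in> M \<Longrightarrow> \<alpha> \<in> terms l n"
  by (auto simp: term_ideal_def)

lemma term_ideal_add: "term_ideal l n M \<Longrightarrow> \<alpha> \<in> M \<Longrightarrow> \<delta> \<in> terms l n \<Longrightarrow> \<alpha> + \<delta> \<in> M"
  by (auto simp: term_ideal_def)

lemma term_ideal_add': "term_ideal l n M \<Longrightarrow> \<alpha> \<in> M \<Longrightarrow> \<delta> \<in> terms l n \<Longrightarrow> \<delta> + \<alpha> \<in> M"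
  by (metis add.commute term_ideal_add)

lemma term_ideal_terms: "term_ideal l n (terms l n)"
  by (simp add: term_ideal_def add_terms)

lemma qstable_ideal: "qstable l n M \<Longrightarrow> term_ideal l n M"
  by (simp add: qstable_def)

lemma stable_fromD: "stable_from s M \<Longrightarrow> \<alpha> \<in> M \<Longrightarrow> s < tdeg \<alpha> \<Longrightarrow> div_min \<alpha> \<in> M"
  by (simp add: stable_from_def)

lemma stable_from_mono: "stable_from s M \<Longrightarrow> s \<le> t \<Longrightarrow> stable_from t M"
  by (auto simp: stable_from_def)

text \<open>The factor x_j lifts the degree above \<open>s\<close> and leaves the smallest variable
  unchanged; dividing by that variable completes the exchange.\<close>

lemma stable_from_exchange:
  assumes "stable_from s M" "term_ideal l n M" "\<alpha> \<in> M" "s \<le> tdeg \<alpha>" "\<alpha> \<noteq> 0" "min_var \<alpha> < j" "j \<le> n"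
  shows "xpow j 1 + div_min \<alpha> \<in> M"
proof -
  have "\<alpha> \<in> terms l n" using assms term_ideal_subset by blast
  then have "l \<le> j" using assms min_var_terms by fastforce
  then have "xpow j 1 + \<alpha> \<in> M"
    using assms by (metis term_ideal_add' xpow_terms)
  moreover have "s < tdeg (xpow j 1 + \<alpha>)" using assms by simp
  ultimately have "div_min (xpow j 1 + \<alpha>) \<in> M" using assms stable_fromD by blast
  then show ?thesis using assms by (simp add: div_min_xpow_add)
qed

lemma stable_from_qstable:
  assumes "stable_from s M" "term_ideal l n M"
  shows "qstable l n M"
  unfolding qstable_def
proof (intro conjI assms ballI impI allI)
  fix \<alpha> j assume a: "\<alpha> \<in> M" "\<alpha> \<noteq> 0" and j: "min_var \<alpha> < j \<and> j \<le> n"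
  have "\<alpha> \<in> terms l n" using assms a term_ideal_subset by blast
  then have "l \<le> j" using a j min_var_terms by fastforce
  then have "xpow j (Suc s) + \<alpha> \<in> M"
    using assms a j by (metis term_ideal_add' xpow_terms)
  moreover have "s < tdeg (xpow j (Suc s) + \<alpha>)" by simp
  ultimately have "div_min (xpow j (Suc s) + \<alpha>) \<in> M" using assms stable_fromD by blast
  then show "\<exists>t. xpow j t + div_min \<alpha> \<in> M" using a j by (auto simp add: div_min_xpow_add)
qed

text \<open>At each stage x_m is the smallest variable of the term, so quasi-stability trades one
  factor x_m for a power of x_j. That power is absorbed into \<open>\<beta>\<close>, which is why
  the induction runs over arbitrary \<open>\<beta>\<close>.\<close>

lemma qstable_replace:
  assumes "qstable l n M"
  shows "\<beta> + xpow m u \<in> M \<Longrightarrow> (\<And>i. expo \<beta> i \<noteq> 0 \<Longrightarrow> m \<le> i) \<Longrightarrow> m < j \<Longrightarrow> j \<le> n \<Longrightarrow>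
    \<exists>t. \<beta> + xpow j t \<in> M"
proof (induction u arbitrary: \<beta>)
  case 0
  then have "\<beta> + xpow j 0 \<in> M" by simp
  then show ?case by blast
next
  case (Suc u)
  let ?a = "\<beta> + xpow m (Suc u)"
  have ne: "?a \<noteq> 0"
    by (metis add_eq_0_iff_both_eq_0 nat.simps(3) tdeg_add tdeg_xpow tdeg_zero)
  have m: "min_var ?a = m"
    by (rule min_var_eqI)
      (auto simp: lookup_add lookup_single when_def Suc.prems split: if_splits)
  have s: "xpow m (Suc u) = xpow m 1 + xpow m u"
    by (simp flip: single_add)
  have d: "div_min ?a = \<beta> + xpow m u"
    by (rule div_min_eqI[OF m]) (simp add: s ac_simps del: One_nat_def)
  obtain t where "xpow j t + (\<beta> + xpow m u) \<in> M"
    using assms Suc.prems ne m d unfolding qstable_def by (metis (no_types, lifting))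
  then have "(\<beta> + xpow j t) + xpow m u \<in> M" by (simp add: ac_simps)
  then have "\<exists>t'. (\<beta> + xpow j t) + xpow j t' \<in> M"
    using Suc.prems by (intro Suc.IH) (auto simp: lookup_add lookup_single when_def split: if_splits)
  then show ?case by (metis single_add add.assoc)
qed

lemma term_sat_subset: "term_ideal l n M \<Longrightarrow> M \<subseteq> term_sat l n M"
  by (auto simp: term_sat_def term_ideal_def xpow_terms)

lemma term_sat_ideal:
  assumes "term_ideal l n M" shows "term_ideal l n (term_sat l n M)"
  unfolding term_ideal_def
proof (intro conjI ballI)
  show "term_sat l n M \<subseteq> terms l n" by (auto simp: term_sat_def)
  fix \<alpha> \<delta> assume a: "\<alpha> \<in> term_sat l n M" and d: "\<delta> \<in> terms l n"
  show "\<alpha> + \<delta> \<in> term_sat l n M" unfolding term_sat_def mem_Collect_eq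
  proof (intro conjI ballI)
    show "\<alpha> + \<delta> \<in> terms l n" using a d by (simp add: term_sat_def add_terms)
    fix j assume "j \<in> {l..n}"
    then obtain t where "\<alpha> + xpow j t \<in> M" using a unfolding term_sat_def by blast
    then have "\<alpha> + xpow j t + \<delta> \<in> M" using assms d term_ideal_add by blast
    then show "\<exists>t. \<alpha> + \<delta> + xpow j t \<in> M" by (metis add.assoc add.commute)
  qed
qed

lemma term_sat_idem:
  "term_ideal l n M \<Longrightarrow> term_sat l n (term_sat l n M) = term_sat l n M"
proof (rule antisym)
  assume M: "term_ideal l n M"
  show "term_sat l n (term_sat l n M) \<subseteq> term_sat l n M"
  proof
    fix \<alpha> assume a: "\<alpha> \<in> term_sat l n (term_sat l n M)"
    { fix j assume j: "j \<in> {l..n}"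
      then obtain t where "\<alpha> + xpow j t \<in> term_sat l n M"
        using a j unfolding term_sat_def by blast
      then obtain t' where "\<alpha> + xpow j t + xpow j t' \<in> M"
        using j unfolding term_sat_def by blast
      then have "\<exists>t. \<alpha> + xpow j t \<in> M" by (metis single_add add.assoc) }
    then show "\<alpha> \<in> term_sat l n M" using a by (auto simp: term_sat_def)
  qed
qed (simp add: term_sat_ideal term_sat_subset)

lemma qstable_term_sat:
  assumes "qstable l n M" shows "qstable l n (term_sat l n M)"
  unfolding qstable_def
proof (intro conjI ballI impI allI)
  have M: "term_ideal l n M" using assms by (rule qstable_ideal)
  then show "term_ideal l n (term_sat l n M)" by (rule term_sat_ideal)
  fix \<alpha> j assume a: "\<alpha> \<in> term_sat l n M" "\<alpha> \<noteq> 0" and j: "min_var \<alpha> < j \<and> j \<le> n"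
  have "\<alpha> \<in> terms l n" using a by (simp add: term_sat_def)
  then obtain u where u: "\<alpha> + xpow (min_var \<alpha>) u \<in> M"
    using a min_var_terms by (fastforce simp: term_sat_def)
  have "div_min \<alpha> + xpow (min_var \<alpha>) (Suc u) = \<alpha> + xpow (min_var \<alpha>) u"
  proof -
    have "xpow (min_var \<alpha>) (Suc u) = xpow (min_var \<alpha>) 1 + xpow (min_var \<alpha>) u"
      by (simp flip: single_add)
    then show ?thesis using div_min_add[OF a(2)] by (metis add.assoc add.commute)
  qed
  with u have "div_min \<alpha> + xpow (min_var \<alpha>) (Suc u) \<in> M" by simp
  moreover have "min_var \<alpha> \<le> i" if "expo (div_min \<alpha>) i \<noteq> 0" for i
    using that by (intro min_var_le) (auto simp: div_min_def lookup_minus)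
  ultimately have "\<exists>t. div_min \<alpha> + xpow j t \<in> M"
    using j by (intro qstable_replace[OF assms]) auto
  then show "\<exists>t. xpow j t + div_min \<alpha> \<in> term_sat l n M"
    using term_sat_subset[OF M] by (metis add.commute subsetD)
qed

text \<open>For quasi-stable ideals the smallest variable alone decides saturation: its powers can
  be traded for powers of any other variable.\<close>

lemma term_sat_low:
  assumes "qstable l n M" "l \<le> n" "\<alpha> \<in> terms l n" "\<alpha> + xpow l t \<in> M"
  shows "\<alpha> \<in> term_sat l n M"
  unfolding term_sat_def
proof (intro CollectI conjI ballI)
  fix j assume j: "j \<in> {l..n}"
  show "\<exists>t. \<alpha> + xpow j t \<in> M"
  proof (cases "j = l")
    case False
    with j have "l < j" "j \<le> n" by auto
    then show ?thesis using assms
      by (intro qstable_replace[OF assms(1,4)]) (auto simp: terms_iff not_less[symmetric])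
  qed (use assms in blast)
qed (use assms in blast)

section \<open>Finiteness of the saturation modulo the ideal\<close>

lemma uniform_exponent:
  assumes "term_ideal l n M" "\<alpha> \<in> term_sat l n M"
  obtains T where "\<And>j. j \<in> {l..n} \<Longrightarrow> \<alpha> + xpow j T \<in> M"
proof -
  have "\<forall>j\<in>{l..n}. \<exists>t. \<alpha> + xpow j t \<in> M"
    using assms(2) by (simp add: term_sat_def)
  from bchoice[OF this] obtain f where f: "\<And>j. j \<in> {l..n} \<Longrightarrow> \<alpha> + xpow j (f j) \<in> M"
    by blast
  have "\<alpha> + xpow j (\<Sum>i\<in>{l..n}. f i) \<in> M" if j: "j \<in> {l..n}" for j
  proof -
    have "f j \<le> (\<Sum>i\<in>{l..n}. f i)" using j by (intro member_le_sum) auto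
    then obtain d where "(\<Sum>i\<in>{l..n}. f i) = f j + d" using le_iff_add by blast
    moreover have "\<alpha> + xpow j (f j) + xpow j d \<in> M"
      using term_ideal_add[OF assms(1) f[OF j] xpow_terms] j by simp
    ultimately show ?thesis by (simp add: single_add add.assoc)
  qed
  then show ?thesis using that by blast
qed

lemma add_mem_of_large_expo:
  assumes "term_ideal l n M" "\<And>j. j \<in> {l..n} \<Longrightarrow> \<alpha> + xpow j T \<in> M" "\<delta> \<in> terms l n"
    "j \<in> {l..n}" "T \<le> expo \<delta> j"
  shows "\<alpha> + \<delta> \<in> M"
proof -
  have e: "\<delta> = xpow j T + (\<delta> - xpow j T)"
    using assms(5) by (intro poly_mapping_eqI) (auto simp: lookup_add lookup_minus lookup_single when_def)
  moreover have "\<delta> - xpow j T \<in> terms l n"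
    using assms(3) by (auto simp: terms_iff lookup_minus)
  ultimately have "\<alpha> + xpow j T + (\<delta> - xpow j T) \<in> M"
    using term_ideal_add[OF assms(1) assms(2)[OF assms(4)]] by blast
  then show ?thesis using e by (simp add: add.assoc)
qed

text \<open>Dickson's lemma, by induction on the number of variables. Finitely many elements
  generate all terms stripped of x_l, and they serve every element whose exponent of x_l is at least
  a bound for theirs; each of the finitely many smaller exponents is a slice of its own.\<close>

lemma dickson:
  assumes "A \<subseteq> terms l n"
  shows "\<exists>F\<subseteq>A. finite F \<and> (\<forall>\<alpha>\<in>A. \<exists>\<beta>\<in>F. \<exists>\<delta>\<in>terms l n. \<alpha> = \<beta> + \<delta>)"
  using assms
proof (induction "Suc n - l" arbitrary: l A)
  case 0
  then have "A \<subseteq> {0}" by (simp add: terms_trivial)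
  then have "finite A" by (rule finite_subset) simp
  then show ?case by (intro exI[of _ A]) (metis add.right_neutral order_refl zero_terms)
next
  case (Suc k)
  then have ln: "l \<le> n" by simp
  define st where "st \<alpha> = \<alpha> - xpow l (expo \<alpha> l)" for \<alpha>
  have st: "st \<alpha> \<in> terms (Suc l) n" "\<alpha> = st \<alpha> + xpow l (expo \<alpha> l)" if "\<alpha> \<in> A" for \<alpha>
  proof -
    have "\<alpha> \<in> terms l n" using Suc.prems that by blast
    then show "st \<alpha> \<in> terms (Suc l) n"
      by (auto simp: terms_iff st_def lookup_minus lookup_single when_def less_Suc_eq)
    show "\<alpha> = st \<alpha> + xpow l (expo \<alpha> l)"
      by (auto simp: st_def lookup_add lookup_minus lookup_single when_def intro!: poly_mapping_eqI)
  qed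
  have IH: "\<exists>F\<subseteq>B. finite F \<and> (\<forall>\<alpha>\<in>B. \<exists>\<beta>\<in>F. \<exists>\<delta>\<in>terms (Suc l) n. st \<alpha> = st \<beta> + \<delta>)"
    if "B \<subseteq> A" for B
  proof -
    have "\<exists>F\<subseteq>st ` B. finite F \<and> (\<forall>\<alpha>\<in>st ` B. \<exists>\<beta>\<in>F. \<exists>\<delta>\<in>terms (Suc l) n. \<alpha> = \<beta> + \<delta>)"
      using Suc.hyps(2) st that by (intro Suc.hyps(1)) auto
    then obtain F where F: "F \<subseteq> st ` B" "finite F"
      "\<forall>\<alpha>\<in>st ` B. \<exists>\<beta>\<in>F. \<exists>\<delta>\<in>terms (Suc l) n. \<alpha> = \<beta> + \<delta>" by blast
    then obtain G where G: "G \<subseteq> B" "finite G" "F = st ` G"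
      using finite_subset_image[of F st B] by blast
    show ?thesis
    proof (intro exI[of _ G] conjI ballI G)
      fix \<alpha> assume "\<alpha> \<in> B"
      then show "\<exists>\<beta>\<in>G. \<exists>\<delta>\<in>terms (Suc l) n. st \<alpha> = st \<beta> + \<delta>" using F(3) G(3) by blast
    qed
  qed
  have lift: "\<exists>\<delta>\<in>terms l n. \<alpha> = \<beta> + \<delta>"
    if "\<alpha> \<in> A" "\<beta> \<in> A" "\<delta> \<in> terms (Suc l) n" "st \<alpha> = st \<beta> + \<delta>" "expo \<beta> l \<le> expo \<alpha> l" for \<alpha> \<beta> \<delta>
  proof -
    have "xpow l (expo \<alpha> l) = xpow l (expo \<beta> l) + xpow l (expo \<alpha> l - expo \<beta> l)"
      using that by (simp flip: single_add)
    then have "st \<alpha> + xpow l (expo \<alpha> l)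
        = (st \<beta> + xpow l (expo \<beta> l)) + (\<delta> + xpow l (expo \<alpha> l - expo \<beta> l))"
      using that(4) by (simp add: ac_simps)
    then have "\<alpha> = \<beta> + (\<delta> + xpow l (expo \<alpha> l - expo \<beta> l))"
      by (simp only: st(2)[OF that(1), symmetric] st(2)[OF that(2), symmetric])
    moreover have "\<delta> + xpow l (expo \<alpha> l - expo \<beta> l) \<in> terms l n"
      by (rule add_terms[OF terms_mono[OF that(3)] xpow_terms[OF order_refl ln]])
    ultimately show ?thesis by blast
  qed
  obtain F where F: "F \<subseteq> A" "finite F" "\<forall>\<alpha>\<in>A. \<exists>\<beta>\<in>F. \<exists>\<delta>\<in>terms (Suc l) n. st \<alpha> = st \<beta> + \<delta>"
    using IH[of A] by blast
  have "\<exists>N. \<forall>\<beta>\<in>F. expo \<beta> l \<le> N"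
    using F(2) by (intro exI[of _ "\<Sum>\<beta>\<in>F. expo \<beta> l"]) (auto intro: member_le_sum)
  then obtain N where N: "\<forall>\<beta>\<in>F. expo \<beta> l \<le> N" by blast
  have "\<forall>c. \<exists>F\<subseteq>{\<alpha>\<in>A. expo \<alpha> l = c}. finite F \<and>
    (\<forall>\<alpha>\<in>{\<alpha>\<in>A. expo \<alpha> l = c}. \<exists>\<beta>\<in>F. \<exists>\<delta>\<in>terms (Suc l) n. st \<alpha> = st \<beta> + \<delta>)"
    by (intro allI IH) auto
  from choice[OF this] obtain G where "\<forall>c. G c \<subseteq> {\<alpha>\<in>A. expo \<alpha> l = c} \<and> finite (G c) \<and>
    (\<forall>\<alpha>\<in>{\<alpha>\<in>A. expo \<alpha> l = c}. \<exists>\<beta>\<in>G c. \<exists>\<delta>\<in>terms (Suc l) n. st \<alpha> = st \<beta> + \<delta>)"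
    by blast
  then have G: "\<And>c. G c \<subseteq> {\<alpha>\<in>A. expo \<alpha> l = c}" "\<And>c. finite (G c)"
    "\<And>c \<alpha>. \<alpha> \<in> A \<Longrightarrow> expo \<alpha> l = c \<Longrightarrow> \<exists>\<beta>\<in>G c. \<exists>\<delta>\<in>terms (Suc l) n. st \<alpha> = st \<beta> + \<delta>"
    by blast+
  show ?case
  proof (intro exI[of _ "F \<union> (\<Union>c<N. G c)"] conjI ballI)
    show "F \<union> (\<Union>c<N. G c) \<subseteq> A" using F G(1) by blast
    show "finite (F \<union> (\<Union>c<N. G c))" using F G(2) by blast
    fix \<alpha> assume a: "\<alpha> \<in> A"
    show "\<exists>\<beta>\<in>F \<union> (\<Union>c<N. G c). \<exists>\<delta>\<in>terms l n. \<alpha> = \<beta> + \<delta>"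
    proof (cases "expo \<alpha> l < N")
      case True
      obtain \<beta> \<delta> where b: "\<beta> \<in> G (expo \<alpha> l)" "\<delta> \<in> terms (Suc l) n" "st \<alpha> = st \<beta> + \<delta>"
        using G(3)[OF a refl] by blast
      then have "\<beta> \<in> A" "expo \<beta> l = expo \<alpha> l" using G(1) by blast+
      then have "\<exists>\<delta>\<in>terms l n. \<alpha> = \<beta> + \<delta>" using lift a b by simp
      then show ?thesis using b True by blast
    next
      case False
      obtain \<beta> \<delta> where b: "\<beta> \<in> F" "\<delta> \<in> terms (Suc l) n" "st \<alpha> = st \<beta> + \<delta>"
        using F(3) a by blast
      then have "\<beta> \<in> A" "expo \<beta> l \<le> expo \<alpha> l" using F(1) N False by force+
      then have "\<exists>\<delta>\<in>terms l n. \<alpha> = \<beta> + \<delta>" using lift a b by simp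
      then show ?thesis using b by blast
    qed
  qed
qed

text \<open>Write an element of the saturation as one of finitely many generators times
  \<open>\<delta>\<close>. Once some exponent of \<open>\<delta>\<close> reaches the uniform
  exponent of the generator, the product lies in \<open>M\<close>; what remains outside has bounded
  exponents.\<close>

lemma finite_term_sat_diff:
  assumes M: "term_ideal l n M"
  shows "finite (term_sat l n M - M)"
proof -
  obtain F where F: "F \<subseteq> term_sat l n M" "finite F"
    "\<forall>\<alpha>\<in>term_sat l n M. \<exists>\<beta>\<in>F. \<exists>\<delta>\<in>terms l n. \<alpha> = \<beta> + \<delta>"
    using dickson[of "term_sat l n M" l n] by (auto simp: term_sat_def)
  have "\<forall>\<beta>\<in>F. \<exists>T. \<forall>j\<in>{l..n}. \<beta> + xpow j T \<in> M"
    using uniform_exponent[OF M] F(1) by (metis subsetD)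
  from bchoice[OF this] obtain T
    where T: "\<And>\<beta> j. \<beta> \<in> F \<Longrightarrow> j \<in> {l..n} \<Longrightarrow> \<beta> + xpow j (T \<beta>) \<in> M"
    by blast
  have "term_sat l n M - M \<subseteq> (\<Union>\<beta>\<in>F. (+) \<beta> ` {\<delta>\<in>terms l n. \<forall>i. expo \<delta> i \<le> T \<beta>})"
  proof
    fix \<alpha> assume a: "\<alpha> \<in> term_sat l n M - M"
    then obtain \<beta> \<delta> where b: "\<beta> \<in> F" "\<delta> \<in> terms l n" "\<alpha> = \<beta> + \<delta>" using F(3) by blast
    have "expo \<delta> i \<le> T \<beta>" for i
    proof (rule ccontr)
      assume c: "\<not> expo \<delta> i \<le> T \<beta>"
      then have "expo \<delta> i \<noteq> 0" by linarith
      then have "i \<in> {l..n}" using b(2) by (metis atLeastAtMost_iff linorder_not_le terms_iff)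
      then have "\<beta> + \<delta> \<in> M" using add_mem_of_large_expo[OF M T[OF b(1)] b(2)] c by simp
      then show False using a b by simp
    qed
    then show "\<alpha> \<in> (\<Union>\<beta>\<in>F. (+) \<beta> ` {\<delta>\<in>terms l n. \<forall>i. expo \<delta> i \<le> T \<beta>})" using b by blast
  qed
  then show ?thesis
    by (rule finite_subset) (intro finite_UN_I finite_imageI finite_bounded_terms F(2))
qed

section \<open>Hilbert functions and cylinders\<close>

definition hilb :: "nat \<Rightarrow> nat \<Rightarrow> pterm set \<Rightarrow> nat \<Rightarrow> nat" where
  "hilb l n M t = card {\<alpha> \<in> terms l n - M. tdeg \<alpha> = t}"

definition cylinder :: "nat \<Rightarrow> pterm set \<Rightarrow> pterm set" where
  "cylinder l B = {\<beta> + xpow l c | \<beta> c. \<beta> \<in> B}"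

definition strip :: "nat \<Rightarrow> pterm \<Rightarrow> pterm" where
  "strip l \<alpha> = \<alpha> - xpow l (expo \<alpha> l)"

lemma strip_terms: "\<alpha> \<in> terms l n \<Longrightarrow> strip l \<alpha> \<in> terms (Suc l) n"
  by (auto simp: terms_iff strip_def lookup_minus lookup_single when_def less_Suc_eq)

lemma strip_add: "strip l \<alpha> + xpow l (expo \<alpha> l) = \<alpha>"
  by (auto simp: strip_def lookup_add lookup_minus lookup_single when_def intro!: poly_mapping_eqI)

lemma strip_eq: "\<beta> \<in> terms (Suc l) n \<Longrightarrow> strip l (\<beta> + xpow l c) = \<beta>"
  by (auto simp: terms_iff strip_def lookup_add lookup_minus lookup_single when_def
      intro!: poly_mapping_eqI)

lemma strip_id: "\<beta> \<in> terms (Suc l) n \<Longrightarrow> strip l \<beta> = \<beta>"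
  using strip_eq[of \<beta> l n 0] by simp

lemma expo_cyl: "\<beta> \<in> terms (Suc l) n \<Longrightarrow> expo (\<beta> + xpow l c) l = c"
  by (simp add: terms_iff lookup_add)

lemma cylinder_iff:
  assumes "B \<subseteq> terms (Suc l) n"
  shows "\<alpha> \<in> cylinder l B \<longleftrightarrow> strip l \<alpha> \<in> B"
proof
  assume "\<alpha> \<in> cylinder l B"
  then show "strip l \<alpha> \<in> B" using assms by (auto simp: cylinder_def strip_eq subset_iff)
next
  assume "strip l \<alpha> \<in> B"
  then show "\<alpha> \<in> cylinder l B"
    unfolding cylinder_def using strip_add[of l \<alpha>, symmetric] by blast
qed

lemma cylinder_subset:
  assumes "B \<subseteq> terms (Suc l) n" "l \<le> n" shows "cylinder l B \<subseteq> terms l n"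
  using assms by (auto simp: cylinder_def intro!: add_terms xpow_terms intro: terms_mono)

lemma card_cylinder:
  assumes "B \<subseteq> terms (Suc l) n"
  shows "card {\<alpha> \<in> cylinder l B. tdeg \<alpha> = t} = (\<Sum>j\<le>t. card {\<beta> \<in> B. tdeg \<beta> = j})"
proof -
  have fin: "finite {\<beta> \<in> B. tdeg \<beta> = j}" for j
    by (rule finite_subset[OF _ finite_terms_tdeg[of "Suc l" n j]]) (use assms in auto)
  have eq: "{\<alpha> \<in> cylinder l B. tdeg \<alpha> = t} = (\<Union>j\<in>{..t}. (\<lambda>\<beta>. \<beta> + xpow l (t - j)) ` {\<beta> \<in> B. tdeg \<beta> = j})"
    by (force simp: cylinder_def)
  have "card \<dots> = (\<Sum>j\<in>{..t}. card ((\<lambda>\<beta>. \<beta> + xpow l (t - j)) ` {\<beta> \<in> B. tdeg \<beta> = j}))"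
  proof (rule card_UN_disjoint)
    show "\<forall>i\<in>{..t}. \<forall>j\<in>{..t}. i \<noteq> j \<longrightarrow>
      (\<lambda>\<beta>. \<beta> + xpow l (t - i)) ` {\<beta> \<in> B. tdeg \<beta> = i} \<inter> (\<lambda>\<beta>. \<beta> + xpow l (t - j)) ` {\<beta> \<in> B. tdeg \<beta> = j} = {}"
    proof (intro ballI impI, rule ccontr)
      fix i j assume ij: "i \<in> {..t}" "j \<in> {..t}" "i \<noteq> j" and
        "(\<lambda>\<beta>. \<beta> + xpow l (t - i)) ` {\<beta> \<in> B. tdeg \<beta> = i} \<inter> (\<lambda>\<beta>. \<beta> + xpow l (t - j)) ` {\<beta> \<in> B. tdeg \<beta> = j} \<noteq> {}"
      then obtain \<beta> \<gamma> where b: "\<beta> \<in> B" "\<gamma> \<in> B" "\<beta> + xpow l (t - i) = \<gamma> + xpow l (t - j)" by auto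
      then have "t - i = t - j" using assms expo_cyl by (metis subsetD)
      then show False using ij by auto
    qed
  qed (use fin in auto)
  also have "\<dots> = (\<Sum>j\<le>t. card {\<beta> \<in> B. tdeg \<beta> = j})"
    by (intro sum.cong refl card_image) (auto simp: inj_on_def)
  finally show ?thesis using eq by simp
qed

lemma terms_cylinder: "l \<le> n \<Longrightarrow> terms l n = cylinder l (terms (Suc l) n)"
  using cylinder_subset[of "terms (Suc l) n" l n] cylinder_iff[of "terms (Suc l) n" l n]
  by (auto simp: strip_terms)

lemma card_terms: "0 < t \<Longrightarrow> card {\<alpha> \<in> terms l n. tdeg \<alpha> = t} = (n + t - l) choose t"
proof (induction "Suc n - l" arbitrary: l t)
  case 0
  then have "{\<alpha> \<in> terms l n. tdeg \<alpha> = t} = {}" by (auto simp: terms_trivial)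
  with 0 show ?case by (simp only: card.empty) (simp add: binomial_eq_0)
next
  case (Suc k)
  then have ln: "l \<le> n" by simp
  have IH: "card {\<alpha> \<in> terms (Suc l) n. tdeg \<alpha> = j} = ((n - l) + j - 1) choose j" if "0 < j" for j
    using Suc.hyps(1)[of "Suc l" j] Suc.hyps(2) that ln by simp
  have "{\<alpha> \<in> terms (Suc l) n. tdeg \<alpha> = 0} = {0}" by auto
  then have z: "card {\<alpha> \<in> terms (Suc l) n. tdeg \<alpha> = 0} = 1" by simp
  \<comment> \<open>Pascal's rule sums the binomials. Degree 0 enters through \<open>z\<close>,
    because \<open>IH\<close> speaks of positive degrees only.\<close>
  have sm: "(\<Sum>j\<le>t. card {\<alpha> \<in> terms (Suc l) n. tdeg \<alpha> = j}) = (n - l + t) choose t" for t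
  proof (induction t)
    case (Suc t)
    then show ?case using IH[of "Suc t"] by simp
  qed (simp add: z del: tdeg_eq_0_iff)
  have "card {\<alpha> \<in> terms l n. tdeg \<alpha> = t} = (\<Sum>j\<le>t. card {\<alpha> \<in> terms (Suc l) n. tdeg \<alpha> = j})"
    by (subst terms_cylinder[OF ln]) (rule card_cylinder, rule order_refl)
  with sm ln show ?case by simp
qed

lemma hilb_cylinder:
  assumes "B \<subseteq> terms (Suc l) n" "l \<le> n"
  shows "hilb l n (cylinder l B) t = (\<Sum>j\<le>t. hilb (Suc l) n B j)"
proof -
  have "terms l n - cylinder l B = cylinder l (terms (Suc l) n - B)"
    using cylinder_iff[of "terms (Suc l) n - B" l n] cylinder_iff[OF assms(1)]
      cylinder_subset[of "terms (Suc l) n - B" l n] assms(2) strip_terms by blast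
  then show ?thesis
    unfolding hilb_def by (simp only:) (rule card_cylinder, blast)
qed

lemma hilb_diff:
  assumes "A \<subseteq> B" "B \<subseteq> terms l n"
  shows "hilb l n A t = hilb l n B t + card {\<alpha> \<in> B - A. tdeg \<alpha> = t}"
proof -
  have "{\<alpha> \<in> terms l n - A. tdeg \<alpha> = t} = {\<alpha> \<in> terms l n - B. tdeg \<alpha> = t} \<union> {\<alpha> \<in> B - A. tdeg \<alpha> = t}"
    using assms by auto
  moreover have "finite {\<alpha> \<in> terms l n - B. tdeg \<alpha> = t}" "finite {\<alpha> \<in> B - A. tdeg \<alpha> = t}"
    by (rule finite_subset[OF _ finite_terms_tdeg[of l n t]], use assms in auto)+
  ultimately show ?thesis
    unfolding hilb_def by (simp add: card_Un_disjoint disjoint_iff)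
qed

text \<open>Dividing an element by its full power of x_l gives an element of the saturation, by
  \<open>term_sat_low\<close>, hence of \<open>M\<close>. Algebraically, x_l is a nonzerodivisor
  modulo \<open>M\<close>.\<close>

lemma term_sat_cylinder:
  assumes M: "term_ideal l n M" and sat: "term_sat l n M = M" and q: "qstable l n M" and ln: "l \<le> n"
  shows "M = cylinder l (M \<inter> terms (Suc l) n)"
proof (rule Set.set_eqI, rule iffI)
  fix \<alpha> assume a: "\<alpha> \<in> M"
  have t: "strip l \<alpha> \<in> terms (Suc l) n" using M a strip_terms term_ideal_subset by blast
  have "strip l \<alpha> + xpow l (expo \<alpha> l) \<in> M" using a by (simp add: strip_add)
  then have "strip l \<alpha> \<in> term_sat l n M" by (rule term_sat_low[OF q ln terms_mono[OF t]])
  then show "\<alpha> \<in> cylinder l (M \<inter> terms (Suc l) n)" using t sat by (subst cylinder_iff) auto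
next
  fix \<alpha> assume "\<alpha> \<in> cylinder l (M \<inter> terms (Suc l) n)"
  then have "strip l \<alpha> \<in> M" by (subst (asm) cylinder_iff) auto
  then have "strip l \<alpha> + xpow l (expo \<alpha> l) \<in> M"
    using term_ideal_add[OF M _ xpow_terms[OF order_refl ln]] by blast
  then show "\<alpha> \<in> M" by (simp add: strip_add)
qed

lemma term_ideal_restrict: "term_ideal l n M \<Longrightarrow> term_ideal (Suc l) n (M \<inter> terms (Suc l) n)"
  by (auto simp: term_ideal_def add_terms terms_mono)

lemma qstable_restrict:
  assumes "qstable l n M" shows "qstable (Suc l) n (M \<inter> terms (Suc l) n)"
  unfolding qstable_def
proof (intro conjI ballI impI allI)
  show "term_ideal (Suc l) n (M \<inter> terms (Suc l) n)"
    using assms qstable_ideal term_ideal_restrict by blast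
  fix \<alpha> j assume a: "\<alpha> \<in> M \<inter> terms (Suc l) n" "\<alpha> \<noteq> 0" "min_var \<alpha> < j \<and> j \<le> n"
  then obtain t where "xpow j t + div_min \<alpha> \<in> M" using assms unfolding qstable_def by blast
  moreover have "Suc l \<le> j" using a min_var_terms[of \<alpha> "Suc l" n] by auto
  ultimately show "\<exists>t. xpow j t + div_min \<alpha> \<in> M \<inter> terms (Suc l) n"
    using a by (intro exI[of _ t]) (simp add: add_terms xpow_terms div_min_terms)
qed

lemma term_ideal_cylinder:
  assumes "term_ideal (Suc l) n B" "l \<le> n" shows "term_ideal l n (cylinder l B)"
  unfolding term_ideal_def
proof (intro conjI ballI)
  have B: "B \<subseteq> terms (Suc l) n" using assms by (simp add: term_ideal_def)
  then show "cylinder l B \<subseteq> terms l n" using assms cylinder_subset by blast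
  fix \<alpha> \<delta> assume "\<alpha> \<in> cylinder l B" and d: "\<delta> \<in> terms l n"
  then obtain \<beta> c where a: "\<alpha> = \<beta> + xpow l c" "\<beta> \<in> B" by (auto simp: cylinder_def)
  have "\<beta> + strip l \<delta> \<in> B" using assms(1) a(2) strip_terms[OF d] by (rule term_ideal_add)
  moreover have "\<alpha> + \<delta> = (\<beta> + strip l \<delta>) + xpow l (c + expo \<delta> l)"
    using strip_add[of l \<delta>] by (simp add: a single_add ac_simps)
  ultimately show "\<alpha> + \<delta> \<in> cylinder l B" unfolding cylinder_def by blast
qed

lemma div_min_low:
  assumes "\<alpha> \<in> terms l n" "expo \<alpha> l \<noteq> 0"
  shows "strip l (div_min \<alpha>) = strip l \<alpha>"
  using assms by (auto simp: strip_def div_min_def min_var_eq_low lookup_minus lookup_add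
      lookup_single when_def intro!: poly_mapping_eqI)

lemma div_min_low_cylinder:
  assumes "B \<subseteq> terms (Suc l) n" "l \<le> n" "\<alpha> \<in> cylinder l B" "expo \<alpha> l \<noteq> 0"
  shows "div_min \<alpha> \<in> cylinder l B"
proof -
  have "\<alpha> \<in> terms l n" using assms cylinder_subset by blast
  then show ?thesis using assms by (simp add: cylinder_iff div_min_low)
qed

lemma stable_from_cylinder:
  assumes "B \<subseteq> terms (Suc l) n" "l \<le> n" and st: "\<And>\<alpha>. \<alpha> \<in> B \<Longrightarrow> s < tdeg \<alpha> \<Longrightarrow> div_min \<alpha> \<in> B"
  shows "stable_from s (cylinder l B)"
  unfolding stable_from_def
proof (intro ballI impI)
  fix \<alpha> assume a: "\<alpha> \<in> cylinder l B" "s < tdeg \<alpha>"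
  show "div_min \<alpha> \<in> cylinder l B"
  proof (cases "expo \<alpha> l = 0")
    case True
    have "\<alpha> \<in> terms l n" using a assms cylinder_subset by blast
    then have t: "\<alpha> \<in> terms (Suc l) n" using True by (simp add: terms_Suc_iff)
    then have "\<alpha> \<in> B" using a assms by (simp add: cylinder_iff strip_id)
    then have "div_min \<alpha> \<in> B" using a st by blast
    then show ?thesis using assms(1) by (simp add: cylinder_iff strip_id[OF div_min_terms[OF t]])
  qed (use assms a div_min_low_cylinder in blast)
qed

text \<open>Written recursively, the value at \<open>t\<close> of the sum over \<open>i \<le> t\<close> of the Gotzmann binomials
  \<open>binom (t - i + a ! i) (a ! i)\<close>. The truncation \<open>i \<le> t\<close> makes it the Hilbert function
  of the saturated lexicographic ideal, a lower bound even in small degrees.\<close>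

primrec gotz :: "nat list \<Rightarrow> nat \<Rightarrow> nat" where
  "gotz [] t = 0"
| "gotz (x # a) t = ((t + x) choose x) + (case t of 0 \<Rightarrow> 0 | Suc u \<Rightarrow> gotz a u)"

lemma gotz_replicate: "gotz (replicate m 0) t = min m (Suc t)"
  by (induction m arbitrary: t) (auto split: nat.splits)

lemma sum_binomial_upper: "(\<Sum>j\<le>t. (j + x) choose x) = (t + Suc x) choose (Suc x)"
  by (induction t) simp_all

text \<open>Raising an exponent by one is summation over the degrees
  (\<open>sum_binomial_upper\<close>). A zero at position i contributes 1 from degree i on, so
  \<open>min m (Suc t - length b)\<close> counts the zeros visible in degree
  \<open>t\<close>.\<close>

lemma gotz_integrate:
  "gotz (map Suc b @ replicate m 0) t = (\<Sum>j\<le>t. gotz b j) + min m (Suc t - length b)"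
proof (induction b arbitrary: t)
  case Nil
  then show ?case by (simp add: gotz_replicate)
next
  case (Cons x b)
  show ?case
  proof (cases t)
    case (Suc u)
    have "(\<Sum>j\<le>Suc u. gotz (x # b) j) = (\<Sum>j\<le>Suc u. (j + x) choose x) + (\<Sum>j\<le>u. gotz b j)"
      unfolding gotz.simps sum.distrib by (subst (2) sum.atMost_Suc_shift) simp
    then show ?thesis using Suc Cons by (simp add: sum_binomial_upper del: sum.atMost_Suc)
  qed simp
qed

text \<open>\<open>b\<close> will be the exponent list of the backward difference
  (\<open>gotz_poly_diff\<close>); the zeros are the constants that differencing loses.\<close>

lemma sorted_desc_split:
  assumes "sorted_wrt (\<ge>) (a :: nat list)"
  obtains b m where "a = map Suc b @ replicate m 0" "sorted_wrt (\<ge>) b"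
proof -
  have "\<exists>b m. a = map Suc b @ replicate m 0 \<and> sorted_wrt (\<ge>) b" using assms
  proof (induction a)
    case (Cons x a)
    then obtain b m where IH: "a = map Suc b @ replicate m 0" "sorted_wrt (\<ge>) b" by auto
    show ?case
    proof (cases x)
      case 0
      then have "b = []" using IH Cons.prems by (cases b) auto
      then show ?thesis using 0 IH by (intro exI[of _ "[]"] exI[of _ "Suc m"]) simp
    next
      case (Suc y)
      then show ?thesis using IH Cons.prems by (intro exI[of _ "y # b"] exI[of _ m]) auto
    qed
  qed simp
  then show ?thesis using that by blast
qed

section \<open>Gotzmann's regularity bound\<close>

lemma hilb_eq_0: "terms l n \<subseteq> M \<Longrightarrow> hilb l n M t = 0"
  unfolding hilb_def by (simp add: Diff_eq_empty_iff[THEN iffD2] del: Diff_eq_empty_iff)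

lemma gotz_pos: "a \<noteq> [] \<Longrightarrow> 0 < gotz a t"
  by (cases a) (auto simp: zero_less_binomial_iff)

text \<open>Stability keeps the successive quotients in \<open>M\<close>, and they stay outside
  \<open>N\<close> because \<open>N\<close> is closed under multiplication.\<close>

lemma stable_chain:
  assumes "stable_from r M" "term_ideal l n N"
    "\<delta> \<in> M - N" "\<delta> \<in> terms l n" "r \<le> k" "k \<le> tdeg \<delta>"
  shows "\<exists>\<gamma>\<in>M - N. tdeg \<gamma> = k"
  using assms(3-6)
proof (induction "tdeg \<delta> - k" arbitrary: \<delta>)
  case 0
  then show ?case by (intro bexI[of _ \<delta>]) auto
next
  case (Suc d)
  then have lt: "k < tdeg \<delta>" by simp
  then have nz: "\<delta> \<noteq> 0" by auto
  have deg: "Suc (tdeg (div_min \<delta>)) = tdeg \<delta>" using nz by (rule tdeg_div_min)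
  have t: "div_min \<delta> \<in> terms l n" using Suc.prems div_min_terms by blast
  have "div_min \<delta> \<in> M" using assms(1) Suc.prems lt stable_fromD by fastforce
  moreover have "div_min \<delta> \<notin> N"
  proof
    assume "div_min \<delta> \<in> N"
    moreover have "xpow (min_var \<delta>) 1 \<in> terms l n"
      using min_var_terms[OF Suc.prems(2) nz] by (intro xpow_terms) auto
    ultimately have "xpow (min_var \<delta>) 1 + div_min \<delta> \<in> N" using assms(2) term_ideal_add' by blast
    then show False using Suc.prems(1) div_min_add[OF nz] by simp
  qed
  ultimately show ?case using Suc.hyps(2) Suc.prems deg lt t by (intro Suc.hyps(1)[of "div_min \<delta>"]) auto
qed

text \<open>The step needs all three conclusions for \<open>N'\<close>: stability for the descent,
  the lower bound to make the subtractions in \<open>c\<close> exact, and equality from degree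
  \<open>r\<close> on to make \<open>c\<close> constant there.\<close>

lemma gotzmann_regularity:
  assumes "qstable l n M" "term_sat l n M = M" "sorted_wrt (\<ge>) a"
    "\<forall>\<^sub>F t in sequentially. hilb l n M t = gotz a t"
  shows "stable_from (length a) M \<and> (\<forall>t. gotz a t \<le> hilb l n M t) \<and>
    (\<forall>t\<ge>length a. hilb l n M t = gotz a t)"
  using assms
proof (induction "Suc n - l" arbitrary: l M a)
  case 0
  then have t: "terms l n = {0}" by (simp add: terms_trivial)
  have M: "M = {0}" using 0 t by (auto simp: term_sat_def)
  then have h: "hilb l n M t = 0" for t using t by (simp add: hilb_eq_0)
  \<comment> \<open>Without variables \<open>M\<close> is the whole ring, whereas
    \<open>gotz\<close> of a nonempty list is positive in every degree.\<close>
  have "a = []"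
  proof (rule ccontr)
    assume "a \<noteq> []"
    then have "hilb l n M t \<noteq> gotz a t" for t using gotz_pos[of a t] h by simp
    then show False using 0 by simp
  qed
  then show ?case using M h by (simp add: stable_from_def)
next
  case (Suc k)
  then have ln: "l \<le> n" by simp
  note q = Suc.prems(1)
  have M: "term_ideal l n M" using q by (rule qstable_ideal)
  define N where "N = M \<inter> terms (Suc l) n"
  define N' where "N' = term_sat (Suc l) n N"
  define D where "D = N' - N"
  have N: "term_ideal (Suc l) n N" unfolding N_def using M by (rule term_ideal_restrict)
  have Nq: "qstable (Suc l) n N" unfolding N_def using q by (rule qstable_restrict)
  have MN: "M = cylinder l N"
    unfolding N_def by (rule term_sat_cylinder[OF M Suc.prems(2) q ln])
  have Nt: "N \<subseteq> terms (Suc l) n" by (simp add: N_def)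
  have NN': "N \<subseteq> N'" unfolding N'_def using N by (rule term_sat_subset)
  have N't: "N' \<subseteq> terms (Suc l) n" by (auto simp: N'_def term_sat_def)
  have N'q: "qstable (Suc l) n N'" unfolding N'_def using Nq by (rule qstable_term_sat)
  have N's: "term_sat (Suc l) n N' = N'" unfolding N'_def using N by (rule term_sat_idem)
  have finD: "finite D" unfolding D_def N'_def using N by (rule finite_term_sat_diff)
  have Dt: "D \<subseteq> terms (Suc l) n" using N't by (auto simp: D_def)
  define h where "h = hilb (Suc l) n N'"
  have hN: "hilb (Suc l) n N j = h j + card {\<delta> \<in> D. tdeg \<delta> = j}" for j
    unfolding h_def D_def by (rule hilb_diff[OF NN' N't])
  define Dle where "Dle t = {\<delta> \<in> D. tdeg \<delta> \<le> t}" for t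
  have cD: "(\<Sum>j\<le>t. card {\<delta> \<in> D. tdeg \<delta> = j}) = card (Dle t)" for t
  proof -
    have "Dle t = (\<Union>j\<in>{..t}. {\<delta> \<in> D. tdeg \<delta> = j})" by (auto simp: Dle_def)
    then show ?thesis
      using finD by (simp only:) (subst card_UN_disjoint, auto)
  qed
  have hM: "hilb l n M t = (\<Sum>j\<le>t. h j) + card (Dle t)" for t
    unfolding MN hilb_cylinder[OF Nt ln] by (simp add: hN sum.distrib cD)
  obtain b m where a: "a = map Suc b @ replicate m 0" and b: "sorted_wrt (\<ge>) b"
    using sorted_desc_split[OF Suc.prems(3)] by blast
  define r where "r = length b"
  have la: "length a = r + m" by (simp add: a r_def)
  have ga: "gotz a t = (\<Sum>j\<le>t. gotz b j) + min m (Suc t - r)" for t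
    by (simp add: a r_def gotz_integrate)
  obtain t0 where t0: "\<And>t. t0 \<le> t \<Longrightarrow> hilb l n M t = gotz a t"
    using Suc.prems(4) by (auto simp: eventually_sequentially)
  define d where "d = (\<Sum>\<delta>\<in>D. tdeg \<delta>)"
  have Dd: "tdeg \<delta> \<le> d" if "\<delta> \<in> D" for \<delta>
    unfolding d_def using that finD by (intro member_le_sum) auto
  have Dle_all: "Dle t = D" if "\<And>\<delta>. \<delta> \<in> D \<Longrightarrow> tdeg \<delta> \<le> t" for t
    using that by (auto simp: Dle_def)
  \<comment> \<open>Difference of two consecutive values: beyond this bound \<open>D\<close> is
    exhausted and all zeros of \<open>a\<close> are visible, so both constants cancel.\<close>
  have "h t = gotz b t" if large: "t0 + d + r + m < t" for t
  proof -
    obtain u where u: "t = Suc u" "t0 \<le> u" "d \<le> u" "r + m \<le> u"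
      using large by (cases t) auto
    have "Dle (Suc u) = D" "Dle u = D" using u Dd by (intro Dle_all, fastforce)+
    then show ?thesis
      using t0[of u] t0[of "Suc u"] u hM[of u] hM[of "Suc u"] ga[of u] ga[of "Suc u"] by simp
  qed
  then have "\<forall>\<^sub>F t in sequentially. hilb (Suc l) n N' t = gotz b t"
    unfolding h_def using eventually_gt_at_top by (rule eventually_mono[rotated])
  then have IH: "stable_from r N'" "\<And>t. gotz b t \<le> h t" "\<And>t. r \<le> t \<Longrightarrow> h t = gotz b t"
    using Suc.hyps(1)[of "Suc l" N' b] Suc.hyps(2) N'q N's b by (auto simp: r_def h_def)
  define c where "c t = (\<Sum>j\<le>t. h j - gotz b j)" for t
  have hc: "(\<Sum>j\<le>t. h j) = (\<Sum>j\<le>t. gotz b j) + c t" for t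
    unfolding c_def by (simp add: IH(2) flip: sum.distrib)
  have cr: "c t = c r" if "r \<le> t" for t
    using that
  proof (induction t rule: dec_induct)
    case (step u)
    then show ?case by (simp add: c_def IH(3))
  qed simp
  \<comment> \<open>Compares the two expressions for the Hilbert function of \<open>M\<close> in a
    single large degree.\<close>
  have cm: "c r + card D = m"
  proof -
    let ?t = "t0 + d + r + m"
    have "Dle ?t = D" using Dd by (intro Dle_all) (simp add: add.assoc trans_le_add1 trans_le_add2)
    then show ?thesis using t0[of ?t] hM[of ?t] hc[of ?t] ga[of ?t] cr[of ?t] by simp
  qed
  \<comment> \<open>\<open>D\<close> meets every degree from \<open>r\<close> to \<open>t\<close>;
    for \<open>t < r\<close> the truncated subtraction makes the claim trivial.\<close>
  have chain: "Suc t - r \<le> card (Dle t)" if "\<delta> \<in> D" "t \<le> tdeg \<delta>" for t \<delta>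
  proof -
    have "{r..t} \<subseteq> tdeg ` Dle t"
    proof
      fix k assume k: "k \<in> {r..t}"
      then have "\<exists>\<gamma>\<in>N' - N. tdeg \<gamma> = k"
        using that Dt by (intro stable_chain[OF IH(1) N, of \<delta>]) (auto simp: D_def)
      then show "k \<in> tdeg ` Dle t" using k by (auto simp: Dle_def D_def)
    qed
    then have "card {r..t} \<le> card (Dle t)"
      using finD by (intro surj_card_le) (auto simp: Dle_def)
    then show ?thesis by simp
  qed
  have Dsmall: "tdeg \<delta> < r + m" if "\<delta> \<in> D" for \<delta>
  proof (rule ccontr)
    assume "\<not> tdeg \<delta> < r + m"
    then have "Suc (tdeg \<delta>) - r > m" by simp
    moreover have "card (Dle (tdeg \<delta>)) \<le> card D"
      using finD by (intro card_mono) (auto simp: Dle_def)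
    ultimately show False using chain[OF that order_refl] cm by simp
  qed
  have "stable_from (r + m) M"
    unfolding MN
  proof (rule stable_from_cylinder[OF Nt ln])
    fix \<alpha> assume al: "\<alpha> \<in> N" "r + m < tdeg \<alpha>"
    then have "div_min \<alpha> \<in> N'" using NN' stable_fromD[OF IH(1), of \<alpha>] by auto
    moreover have "Suc (tdeg (div_min \<alpha>)) = tdeg \<alpha>" using al by (intro tdeg_div_min) auto
    ultimately show "div_min \<alpha> \<in> N" using al Dsmall[of "div_min \<alpha>"] by (auto simp: D_def)
  qed
  \<comment> \<open>Either \<open>D\<close> is exhausted and \<open>cm\<close> accounts for all
    zeros (none is visible for \<open>t < r\<close>), or \<open>D\<close> has a later element and
    \<open>chain\<close> yields one element of \<open>D\<close> for each zero visible in degree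
    \<open>t\<close>.\<close>
  moreover have "gotz a t \<le> hilb l n M t" for t
  proof (cases "\<forall>\<delta>\<in>D. tdeg \<delta> \<le> t")
    case True
    then have "Dle t = D" by (intro Dle_all) auto
    then show ?thesis using hM[of t] hc[of t] ga[of t] cr[of t] cm by (cases "r \<le> t") auto
  next
    case False
    then obtain \<delta> where "\<delta> \<in> D" "t \<le> tdeg \<delta>" by force
    then have "Suc t - r \<le> card (Dle t)" by (rule chain)
    then show ?thesis using hM[of t] hc[of t] ga[of t] by simp
  qed
  moreover have "hilb l n M t = gotz a t" if "r + m \<le> t" for t
  proof -
    have "Dle t = D" using Dsmall that by (intro Dle_all) fastforce
    then show ?thesis using hM[of t] hc[of t] ga[of t] cr[of t] cm that by simp
  qed
  ultimately show ?case by (simp add: la)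
qed

section \<open>Monomial ideals of the polynomial ring\<close>

text \<open>A polynomial lies in a monomial ideal exactly when all its terms do, so for a
  \<open>term_ideal\<close> the condition on the support already describes the ideal.\<close>

definition mspan :: "pterm set \<Rightarrow> 'k::field mpoly set" where
  "mspan M = {f. Poly_Mapping.keys f \<subseteq> M}"

definition term_hull :: "nat \<Rightarrow> nat \<Rightarrow> pterm set \<Rightarrow> pterm set" where
  "term_hull l n G = {\<alpha> + \<delta> | \<alpha> \<delta>. \<alpha> \<in> G \<and> \<delta> \<in> terms l n}"

lemma term_hull_ideal:
  assumes "G \<subseteq> terms l n" shows "term_ideal l n (term_hull l n G)"
  unfolding term_ideal_def
proof (intro conjI ballI)
  show "term_hull l n G \<subseteq> terms l n" using assms by (auto simp: term_hull_def add_terms)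
  fix \<alpha> \<epsilon> assume "\<alpha> \<in> term_hull l n G" and e: "\<epsilon> \<in> terms l n"
  then obtain \<beta> \<delta> where b: "\<alpha> = \<beta> + \<delta>" "\<beta> \<in> G" "\<delta> \<in> terms l n" by (auto simp: term_hull_def)
  then have "\<alpha> + \<epsilon> = \<beta> + (\<delta> + \<epsilon>)" "\<delta> + \<epsilon> \<in> terms l n" using e by (simp_all add: add.assoc add_terms)
  then show "\<alpha> + \<epsilon> \<in> term_hull l n G" using b unfolding term_hull_def by blast
qed

lemma subset_term_hull: "G \<subseteq> term_hull l n G"
proof
  fix \<alpha> assume "\<alpha> \<in> G"
  moreover have "\<alpha> = \<alpha> + 0" by simp
  ultimately show "\<alpha> \<in> term_hull l n G" unfolding term_hull_def using zero_terms by blast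
qed

lemma term_hull_minimal: "term_ideal l n M \<Longrightarrow> G \<subseteq> M \<Longrightarrow> term_hull l n G \<subseteq> M"
  by (auto simp: term_hull_def term_ideal_def)

lemma term_hull_id: "term_ideal l n M \<Longrightarrow> term_hull l n M = M"
  by (simp add: subset_antisym subset_term_hull term_hull_minimal)

lemma mpoly_ring_simps [simp]:
  "carrier (mpoly_ring l n) = mspan (terms l n)"
  "monoid.mult (mpoly_ring l n) = (*)" "one (mpoly_ring l n) = 1"
  "zero (mpoly_ring l n) = 0" "add (mpoly_ring l n) = (+)"
  by (simp_all add: mpoly_ring_def mspan_def)

lemma monom_of_in_mspan [simp]: "monom_of \<alpha> \<in> (mspan M :: 'k::field mpoly set) \<longleftrightarrow> \<alpha> \<in> M"
  by (simp add: mspan_def monom_of_def)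

lemma mspan_inject [simp]: "(mspan M :: 'k::field mpoly set) = mspan N \<longleftrightarrow> M = N"
  by (metis monom_of_in_mspan subsetI subset_antisym)

lemma mspan_mono: "M \<subseteq> N \<Longrightarrow> mspan M \<subseteq> mspan N"
  by (auto simp: mspan_def)

lemma zero_in_mspan: "0 \<in> mspan M"
  by (simp add: mspan_def)

lemma add_in_mspan: "f \<in> mspan M \<Longrightarrow> g \<in> mspan M \<Longrightarrow> f + g \<in> mspan M"
  using Poly_Mapping.keys_add[of f g] by (auto simp: mspan_def)

lemma uminus_in_mspan: "f \<in> mspan M \<Longrightarrow> - f \<in> mspan M"
  by (simp add: mspan_def in_keys_iff subset_iff)

lemma mult_in_mspan:
  assumes "f \<in> mspan M" "g \<in> mspan N" "\<And>\<alpha> \<beta>. \<alpha> \<in> M \<Longrightarrow> \<beta> \<in> N \<Longrightarrow> \<alpha> + \<beta> \<in> K"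
  shows "f * g \<in> mspan K"
  using Poly_Mapping.keys_mult[of f g] assms by (fastforce simp: mspan_def)

lemma mpoly_expand: "f = (\<Sum>\<alpha>\<in>Poly_Mapping.keys f. Poly_Mapping.single \<alpha> (Poly_Mapping.lookup f \<alpha>))"
  for f :: "'k::field mpoly"
proof (rule poly_mapping_eqI)
  fix \<beta>
  have "Poly_Mapping.lookup (\<Sum>\<alpha>\<in>Poly_Mapping.keys f. Poly_Mapping.single \<alpha> (Poly_Mapping.lookup f \<alpha>)) \<beta>
     = (\<Sum>\<alpha>\<in>Poly_Mapping.keys f. if \<alpha> = \<beta> then Poly_Mapping.lookup f \<beta> else 0)"
    unfolding lookup_sum by (rule sum.cong) (auto simp: lookup_single when_def)
  then show "Poly_Mapping.lookup f \<beta> =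
      Poly_Mapping.lookup (\<Sum>\<alpha>\<in>Poly_Mapping.keys f. Poly_Mapping.single \<alpha> (Poly_Mapping.lookup f \<alpha>)) \<beta>"
    by (simp add: in_keys_iff)
qed

text \<open>Multiplication by a monomial shifts the support without cancellation, so a product lying
  in \<open>mspan M\<close> gives information on each term of \<open>f\<close> separately.\<close>

lemma lookup_mult_monom:
  fixes f :: "'k::field mpoly"
  shows "Poly_Mapping.lookup (f * monom_of \<beta>) (\<gamma> + \<beta>) = Poly_Mapping.lookup f \<gamma>"
proof -
  have "f * monom_of \<beta> = (\<Sum>\<alpha>\<in>Poly_Mapping.keys f. Poly_Mapping.single (\<alpha> + \<beta>) (Poly_Mapping.lookup f \<alpha>))"
    by (subst mpoly_expand[of f]) (simp add: monom_of_def sum_distrib_right mult_single)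
  then have "Poly_Mapping.lookup (f * monom_of \<beta>) (\<gamma> + \<beta>) =
      (\<Sum>\<alpha>\<in>Poly_Mapping.keys f. if \<alpha> = \<gamma> then Poly_Mapping.lookup f \<gamma> else 0)"
    by (simp only: lookup_sum) (rule sum.cong, auto simp: lookup_single when_def)
  then show ?thesis by (simp add: in_keys_iff)
qed

lemma ring_mpoly_ring: "ring (mpoly_ring l n :: 'k::field mpoly ring)"
proof (rule ringI)
  show "abelian_group (mpoly_ring l n)"
  proof (rule abelian_groupI, goal_cases)
    case (6 f)
    then show ?case by (intro bexI[of _ "- f"]) (simp_all add: uminus_in_mspan)
  qed (simp_all add: zero_in_mspan add_in_mspan add.assoc add.commute)
  show "Group.monoid (mpoly_ring l n)"
  proof (rule monoidI)
    show "\<one>\<^bsub>mpoly_ring l n\<^esub> \<in> carrier (mpoly_ring l n)" by (simp add: mspan_def)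
  qed (auto simp: mult.assoc intro: mult_in_mspan add_terms)
qed (simp_all add: distrib_left distrib_right)

lemma ideal_mspan:
  assumes M: "term_ideal l n M"
  shows "ideal (mspan M :: 'k::field mpoly set) (mpoly_ring l n)"
proof (rule idealI[OF ring_mpoly_ring])
  interpret ring "mpoly_ring l n :: 'k mpoly ring" by (rule ring_mpoly_ring)
  let ?I = "mspan M :: 'k mpoly set" and ?R = "mpoly_ring l n :: 'k mpoly ring"
  have sub: "?I \<subseteq> mspan (terms l n)"
    using M by (intro mspan_mono) (auto simp: term_ideal_def)
  show "subgroup ?I (add_monoid ?R)"
  proof (rule add.subgroupI)
    show "?I \<subseteq> carrier ?R" using sub by simp
    show "?I \<noteq> {}" using zero_in_mspan by blast
    fix f g assume f: "f \<in> ?I"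
    have "\<ominus>\<^bsub>?R\<^esub> f = - f"
      by (rule minus_equality) (use f sub in \<open>auto intro: uminus_in_mspan\<close>)
    then show "\<ominus>\<^bsub>?R\<^esub> f \<in> ?I" using f by (simp add: uminus_in_mspan)
    assume "g \<in> ?I"
    then show "f \<oplus>\<^bsub>?R\<^esub> g \<in> ?I" using f by (simp add: add_in_mspan)
  qed
  fix f g assume f: "f \<in> ?I" and g: "g \<in> carrier ?R"
  show "g \<otimes>\<^bsub>?R\<^esub> f \<in> ?I"
    using f g by (auto intro: mult_in_mspan term_ideal_add'[OF M])
  show "f \<otimes>\<^bsub>?R\<^esub> g \<in> ?I"
    using f g by (auto intro: mult_in_mspan term_ideal_add[OF M])
qed

lemma ideal_mpoly_closed:
  assumes "ideal I (mpoly_ring l n)"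
  shows "0 \<in> I" "f \<in> I \<Longrightarrow> g \<in> I \<Longrightarrow> f + g \<in> I" "f \<in> I \<Longrightarrow> h \<in> mspan (terms l n) \<Longrightarrow> h * f \<in> I"
  using additive_subgroup.zero_closed[OF ideal.axioms(1)[OF assms]]
    additive_subgroup.a_closed[OF ideal.axioms(1)[OF assms], of f g]
    ideal.I_l_closed[OF assms, of f h] by simp_all

text \<open>Leaving \<open>X\<close> between two bounds covers both ways in which the algorithm
  generates ideals: from monomials in \<open>Remove\<close>, and from a whole ideal of the smaller
  ring in \<open>QuasiStable\<close>.\<close>

lemma genideal_eq_mspan:
  fixes X :: "'k::field mpoly set"
  assumes G: "G \<subseteq> terms l n" and X: "monom_of ` G \<subseteq> X" "X \<subseteq> mspan (term_hull l n G)"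
  shows "Idl\<^bsub>mpoly_ring l n\<^esub> X = mspan (term_hull l n G)"
proof
  interpret ring "mpoly_ring l n :: 'k mpoly ring" by (rule ring_mpoly_ring)
  have id: "ideal (mspan (term_hull l n G) :: 'k mpoly set) (mpoly_ring l n)"
    by (rule ideal_mspan[OF term_hull_ideal[OF G]])
  then show "Idl\<^bsub>mpoly_ring l n\<^esub> X \<subseteq> mspan (term_hull l n G)"
    using X(2) by (rule genideal_minimal)
  have "X \<subseteq> carrier (mpoly_ring l n)"
    using X(2) term_hull_ideal[OF G] by (fastforce simp: term_ideal_def mspan_def)
  then have I: "ideal (Idl\<^bsub>mpoly_ring l n\<^esub> X) (mpoly_ring l n)" and XI: "X \<subseteq> Idl\<^bsub>mpoly_ring l n\<^esub> X"
    by (rule genideal_ideal, rule genideal_self)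
  show "mspan (term_hull l n G) \<subseteq> Idl\<^bsub>mpoly_ring l n\<^esub> X"
  proof
    fix f :: "'k mpoly" assume f: "f \<in> mspan (term_hull l n G)"
    have mon: "Poly_Mapping.single \<alpha> c \<in> Idl\<^bsub>mpoly_ring l n\<^esub> X" if a: "\<alpha> \<in> Poly_Mapping.keys f" for \<alpha> and c :: 'k
    proof -
      obtain \<beta> \<delta> where b: "\<beta> \<in> G" "\<delta> \<in> terms l n" "\<alpha> = \<beta> + \<delta>"
        using f a by (auto simp: mspan_def term_hull_def)
      have "Poly_Mapping.single \<delta> c * monom_of \<beta> \<in> Idl\<^bsub>mpoly_ring l n\<^esub> X"
        using X(1) XI b by (intro ideal_mpoly_closed(3)[OF I]) (auto simp: mspan_def)
      then show ?thesis by (simp add: monom_of_def mult_single b add.commute)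
    qed
    have "(\<Sum>\<alpha>\<in>A. Poly_Mapping.single \<alpha> (Poly_Mapping.lookup f \<alpha>)) \<in> Idl\<^bsub>mpoly_ring l n\<^esub> X"
      if "finite A" "A \<subseteq> Poly_Mapping.keys f" for A
      using that by (induction A) (auto intro!: ideal_mpoly_closed[OF I] mon)
    from this[of "Poly_Mapping.keys f"] show "f \<in> Idl\<^bsub>mpoly_ring l n\<^esub> X"
      by (simp flip: mpoly_expand)
  qed
qed

lemma genideal_monom_of:
  assumes "G \<subseteq> terms l n"
  shows "Idl\<^bsub>mpoly_ring l n\<^esub> (monom_of ` G) = mspan (term_hull l n G)"
  using assms subset_term_hull[of G l n] by (intro genideal_eq_mspan) auto

lemma genideal_mspan:
  assumes "G \<subseteq> terms l n"
  shows "Idl\<^bsub>mpoly_ring l n\<^esub> (mspan G) = mspan (term_hull l n G)"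
  using assms subset_term_hull[of G l n] by (intro genideal_eq_mspan mspan_mono) auto

lemma genideal_one: "Idl\<^bsub>mpoly_ring l n\<^esub> {1} = mspan (terms l n)"
  using genideal_monom_of[of "{0}" l n] by (simp add: monom_of_def term_hull_def)

lemma quasi_stable_iff:
  "quasi_stable l n J \<longleftrightarrow> (\<exists>M. qstable l n M \<and> J = mspan M)"
proof
  assume J: "quasi_stable l n J"
  then obtain G where G: "G \<subseteq> terms l n" "J = mspan (term_hull l n G)"
    by (auto simp: quasi_stable_def monomial_ideal_def genideal_monom_of)
  then have "term_ideal l n (term_hull l n G)" by (intro term_hull_ideal)
  then have "qstable l n (term_hull l n G)"
    using J by (auto simp: qstable_def quasi_stable_def G term_ideal_def)
  then show "\<exists>M. qstable l n M \<and> J = mspan M" using G by blast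
next
  assume "\<exists>M. qstable l n M \<and> J = mspan M"
  then obtain M where M: "qstable l n M" "J = mspan M" by blast
  then have "M \<subseteq> terms l n" "J = Idl\<^bsub>mpoly_ring l n\<^esub> (monom_of ` M)"
    by (auto simp: genideal_monom_of term_hull_id qstable_def term_ideal_def)
  then have "monomial_ideal l n J" unfolding monomial_ideal_def by blast
  then show "quasi_stable l n J"
    using M by (simp add: quasi_stable_def qstable_def)
qed

section \<open>Powers of the irrelevant ideal and the saturation\<close>

lemma irrelevant_ideal_eq: "irrelevant_ideal l n = mspan (terms l n - {0})"
proof -
  let ?G = "(\<lambda>i. xpow i 1) ` {l..n}"
  have "irrelevant_ideal l n = mspan (term_hull l n ?G)"
    unfolding irrelevant_ideal_def image_image[symmetric, of monom_of "\<lambda>i. xpow i 1"]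
    by (rule genideal_monom_of) (auto intro!: xpow_terms)
  moreover have "term_hull l n ?G = terms l n - {0}"
  proof (intro subset_antisym subsetI)
    fix \<alpha> assume "\<alpha> \<in> term_hull l n ?G"
    then obtain i \<delta> where a: "\<alpha> = xpow i 1 + \<delta>" "i \<in> {l..n}" "\<delta> \<in> terms l n"
      by (auto simp: term_hull_def)
    then have "tdeg \<alpha> = Suc (tdeg \<delta>)" by simp
    then have "\<alpha> \<noteq> 0" by force
    then show "\<alpha> \<in> terms l n - {0}" using a by (auto intro!: add_terms xpow_terms)
  next
    fix \<alpha> assume a: "\<alpha> \<in> terms l n - {0}"
    then have "\<alpha> = xpow (min_var \<alpha>) 1 + div_min \<alpha>" "min_var \<alpha> \<in> {l..n}" "div_min \<alpha> \<in> terms l n"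
      using div_min_add[of \<alpha>] min_var_terms[of \<alpha>] div_min_terms[of \<alpha>] by auto
    then show "\<alpha> \<in> term_hull l n ?G" unfolding term_hull_def by blast
  qed
  ultimately show ?thesis by simp
qed

text \<open>The powers are not computed exactly: for the saturation it is enough that their terms
  have large degree and, by \<open>monom_of_in_ideal_power\<close>, that they contain the pure
  powers.\<close>

lemma ideal_power_subset:
  "(ideal_power l n (irrelevant_ideal l n) t :: 'k::field mpoly set) \<subseteq> mspan {\<alpha> \<in> terms l n. t \<le> tdeg \<alpha>}"
proof (induction t)
  case (Suc t)
  show ?case
  proof
    fix f :: "'k mpoly" assume "f \<in> ideal_power l n (irrelevant_ideal l n) (Suc t)"
    then have "f \<in> ideal_prod (mpoly_ring l n) (irrelevant_ideal l n) (ideal_power l n (irrelevant_ideal l n) t)"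
      by simp
    then show "f \<in> mspan {\<alpha> \<in> terms l n. Suc t \<le> tdeg \<alpha>}"
    proof induction
      case (prod i j)
      have "\<alpha> + \<beta> \<in> {\<alpha> \<in> terms l n. Suc t \<le> tdeg \<alpha>}"
        if "\<alpha> \<in> terms l n - {0}" "\<beta> \<in> {\<alpha> \<in> terms l n. t \<le> tdeg \<alpha>}" for \<alpha> \<beta>
      proof -
        have "tdeg \<alpha> \<noteq> 0" using that by simp
        then show ?thesis using that by (auto simp: add_terms simp del: tdeg_eq_0_iff)
      qed
      then show ?case using prod Suc mult_in_mspan unfolding irrelevant_ideal_eq mpoly_ring_simps by blast
    qed (simp add: add_in_mspan)
  qed
qed simp

lemma monom_of_in_ideal_power:
  "j \<in> {l..n} \<Longrightarrow> monom_of (xpow j t) \<in> ideal_power l n (irrelevant_ideal l n) t"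
proof (induction t)
  case (Suc t)
  have "xpow j 1 \<noteq> 0" by (metis tdeg_xpow tdeg_zero zero_neq_one)
  then have "monom_of (xpow j 1) \<in> irrelevant_ideal l n"
    using Suc.prems by (auto simp add: irrelevant_ideal_eq intro!: xpow_terms)
  from ideal_prod.prod[OF this Suc.IH[OF Suc.prems], of "mpoly_ring l n"]
  show ?case by (simp add: monom_of_def mult_single flip: single_add)
qed simp

lemma saturation_mspan:
  assumes M: "term_ideal l n M"
  shows "saturation l n (mspan M :: 'k::field mpoly set) = mspan (term_sat l n M)"
proof (intro subset_antisym subsetI)
  fix f :: "'k mpoly" assume "f \<in> saturation l n (mspan M)"
  then obtain t where f: "f \<in> mspan (terms l n)"
    and t: "\<And>g. g \<in> ideal_power l n (irrelevant_ideal l n) t \<Longrightarrow> f * g \<in> mspan M"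
    by (auto simp: saturation_def ideal_colon_def)
  show "f \<in> mspan (term_sat l n M)" unfolding mspan_def
  proof (intro CollectI subsetI)
    fix \<alpha> assume a: "\<alpha> \<in> Poly_Mapping.keys f"
    have "\<alpha> + xpow j t \<in> M" if "j \<in> {l..n}" for j
    proof -
      have "f * monom_of (xpow j t) \<in> mspan M" by (rule t[OF monom_of_in_ideal_power[OF that]])
      moreover have "\<alpha> + xpow j t \<in> Poly_Mapping.keys (f * monom_of (xpow j t))"
        using a by (simp add: in_keys_iff lookup_mult_monom)
      ultimately show ?thesis by (auto simp: mspan_def)
    qed
    then show "\<alpha> \<in> term_sat l n M" using a f by (auto simp: term_sat_def mspan_def intro!: exI[of _ t])
  qed
next
  fix f :: "'k mpoly" assume f: "f \<in> mspan (term_sat l n M)"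
  have "\<forall>\<alpha>\<in>Poly_Mapping.keys f. \<exists>T. \<forall>j\<in>{l..n}. \<alpha> + xpow j T \<in> M"
    using f uniform_exponent[OF M] by (metis CollectD mspan_def subsetD)
  from bchoice[OF this] obtain T
    where T: "\<And>\<alpha> j. \<alpha> \<in> Poly_Mapping.keys f \<Longrightarrow> j \<in> {l..n} \<Longrightarrow> \<alpha> + xpow j (T \<alpha>) \<in> M"
    by blast
  define U where "U = (\<Sum>\<alpha>\<in>Poly_Mapping.keys f. T \<alpha>)"
  \<comment> \<open>Pigeonhole: a term of degree above \<open>card {l..n} * U\<close> has some
    exponent of at least \<open>U\<close>.\<close>
  define N where "N = Suc (card {l..n} * U)"
  have "f * g \<in> mspan M" if g: "g \<in> ideal_power l n (irrelevant_ideal l n) N" for g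
  proof (rule mult_in_mspan)
    show "f \<in> mspan (Poly_Mapping.keys f)" by (simp add: mspan_def)
    show "g \<in> mspan {\<alpha> \<in> terms l n. N \<le> tdeg \<alpha>}" using g ideal_power_subset by blast
    fix \<alpha> \<delta> assume a: "\<alpha> \<in> Poly_Mapping.keys f" and d: "\<delta> \<in> {\<alpha> \<in> terms l n. N \<le> tdeg \<alpha>}"
    have "\<exists>j\<in>{l..n}. U \<le> expo \<delta> j"
    proof (rule ccontr)
      assume "\<not> ?thesis"
      then have "(\<Sum>j\<in>{l..n}. expo \<delta> j) \<le> (\<Sum>j\<in>{l..n}. U)" by (intro sum_mono) force
      moreover have "tdeg \<delta> = (\<Sum>j\<in>{l..n}. expo \<delta> j)"
        using d by (intro tdeg_superset) (auto simp: terms_def)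
      ultimately show False using d by (simp add: N_def)
    qed
    then obtain j where j: "j \<in> {l..n}" "U \<le> expo \<delta> j" by blast
    moreover have "T \<alpha> \<le> U" unfolding U_def using a by (intro member_le_sum) auto
    ultimately show "\<alpha> + \<delta> \<in> M"
      using d by (intro add_mem_of_large_expo[OF M T[OF a]]) auto
  qed
  moreover have "f \<in> mspan (terms l n)" using f by (auto simp: mspan_def term_sat_def)
  ultimately show "f \<in> saturation l n (mspan M)"
    unfolding saturation_def ideal_colon_def by auto
qed

lemma saturated_mspan_iff:
  "term_ideal l n M \<Longrightarrow> saturated l n (mspan M :: 'k::field mpoly set) \<longleftrightarrow> term_sat l n M = M"
  by (simp add: saturated_def ideal_mspan saturation_mspan)

section \<open>Graded parts, their dimensions, and truncations\<close>

lemma graded_part_mspan: "graded_part (mspan M) t = mspan {\<alpha> \<in> M. tdeg \<alpha> = t}"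
  by (auto simp: graded_part_def mspan_def)

lemma subspace_mspan: "poly_vs.subspace (mspan M :: 'k::field mpoly set)"
proof (rule poly_vs.subspaceI)
  fix c :: 'k and f :: "'k mpoly" assume f: "f \<in> mspan M"
  have "Poly_Mapping.single 0 c \<in> mspan {0}" by (simp add: mspan_def)
  then have "Poly_Mapping.single 0 c * f \<in> mspan M" using f by (rule mult_in_mspan) simp
  then show "pscale c f \<in> mspan M" by (simp add: pscale_def)
qed (simp_all add: zero_in_mspan add_in_mspan)

lemma pscale_monom_of: "pscale c (monom_of \<alpha>) = Poly_Mapping.single \<alpha> c"
  by (simp add: pscale_def monom_of_def mult_single)

lemma inj_monom_of: "inj (monom_of :: pterm \<Rightarrow> 'k::field mpoly)"
proof (rule injI)
  fix \<alpha> \<beta> assume "(monom_of \<alpha> :: 'k mpoly) = monom_of \<beta>"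
  then have "Poly_Mapping.keys (monom_of \<alpha> :: 'k mpoly) = Poly_Mapping.keys (monom_of \<beta> :: 'k mpoly)" by simp
  then show "\<alpha> = \<beta>" by (simp add: monom_of_def)
qed

lemma dim_mspan:
  assumes A: "finite A"
  shows "poly_vs.dim (mspan A :: 'k::field mpoly set) = card A"
proof -
  let ?B = "monom_of ` A :: 'k mpoly set"
  have inj: "inj_on (monom_of :: pterm \<Rightarrow> 'k mpoly) A" using inj_monom_of by (rule inj_on_subset) simp
  have "card ?B = poly_vs.dim (mspan A :: 'k mpoly set)"
  proof (rule poly_vs.basis_card_eq_dim)
    show "?B \<subseteq> mspan A" by auto
    show "mspan A \<subseteq> poly_vs.span ?B"
    proof
      fix f :: "'k mpoly" assume f: "f \<in> mspan A"
      have "(\<Sum>\<alpha>\<in>Poly_Mapping.keys f. pscale (Poly_Mapping.lookup f \<alpha>) (monom_of \<alpha>)) \<in> poly_vs.span ?B"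
        using f by (intro poly_vs.span_sum poly_vs.span_scale poly_vs.span_base) (auto simp: mspan_def)
      then show "f \<in> poly_vs.span ?B" by (simp add: pscale_monom_of flip: mpoly_expand)
    qed
    show "poly_vs.independent ?B"
    proof (rule ccontr)
      assume "\<not> poly_vs.independent ?B"
      then obtain u where u: "\<exists>v\<in>?B. u v \<noteq> 0" "(\<Sum>v\<in>?B. pscale (u v) v) = 0"
        using A by (auto simp: poly_vs.dependent_finite)
      have s: "(\<Sum>\<alpha>\<in>A. Poly_Mapping.single \<alpha> (u (monom_of \<alpha>))) = 0"
        using u(2) by (simp add: sum.reindex[OF inj] pscale_monom_of)
      have "u (monom_of \<beta>) = 0" if "\<beta> \<in> A" for \<beta>
      proof -
        have "0 = Poly_Mapping.lookup (\<Sum>\<alpha>\<in>A. Poly_Mapping.single \<alpha> (u (monom_of \<alpha>))) \<beta>"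
          using s by simp
        also have "\<dots> = (\<Sum>\<alpha>\<in>A. if \<alpha> = \<beta> then u (monom_of \<beta>) else 0)"
          unfolding lookup_sum by (rule sum.cong) (auto simp: lookup_single when_def)
        finally show ?thesis using that A by simp
      qed
      then show False using u(1) by auto
    qed
  qed
  then show ?thesis using inj by (simp add: card_image)
qed

lemma dim_graded_part:
  assumes "M \<subseteq> terms l n"
  shows "poly_vs.dim (graded_part (mspan M :: 'k::field mpoly set) t) = card {\<alpha> \<in> M. tdeg \<alpha> = t}"
  unfolding graded_part_mspan
  by (rule dim_mspan, rule finite_subset[OF _ finite_terms_tdeg[of l n t]]) (use assms in auto)

lemma monom_of_in_truncation:
  "monom_of \<beta> \<in> truncation (mspan M :: 'k::field mpoly set) s \<longleftrightarrow> \<beta> \<in> M \<and> s \<le> tdeg \<beta>"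
proof
  have "truncation (mspan M :: 'k mpoly set) s \<subseteq> mspan {\<beta> \<in> M. s \<le> tdeg \<beta>}"
    unfolding truncation_def
    by (rule poly_vs.span_minimal[OF _ subspace_mspan]) (auto simp: graded_part_def mspan_def)
  moreover assume "monom_of \<beta> \<in> truncation (mspan M :: 'k mpoly set) s"
  ultimately have "(monom_of \<beta> :: 'k mpoly) \<in> mspan {\<beta> \<in> M. s \<le> tdeg \<beta>}" by blast
  then show "\<beta> \<in> M \<and> s \<le> tdeg \<beta>" by simp
next
  assume "\<beta> \<in> M \<and> s \<le> tdeg \<beta>"
  then show "monom_of \<beta> \<in> truncation (mspan M :: 'k mpoly set) s"
    unfolding truncation_def graded_part_mspan
    by (intro poly_vs.span_base UN_I[of "tdeg \<beta>"]) auto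
qed

section \<open>The removal procedure\<close>

text \<open>Counterpart of \<open>st_minimal\<close> for sets of terms; the lower index
  \<open>l\<close> is implicit in \<open>M\<close> (\<open>st_minimal_mspan\<close>).\<close>

definition st_min :: "nat \<Rightarrow> pterm set \<Rightarrow> nat \<Rightarrow> pterm \<Rightarrow> bool" where
  "st_min n M s \<alpha> \<longleftrightarrow> \<alpha> \<in> M \<and> tdeg \<alpha> = s \<and>
     (\<forall>\<beta>\<in>M. \<beta> \<noteq> 0 \<longrightarrow> s \<le> tdeg \<beta> \<longrightarrow>
        (\<forall>j. min_var \<beta> < j \<and> j \<le> n \<longrightarrow> xpow j 1 + div_min \<beta> \<noteq> \<alpha>))"

lemma st_minD:
  assumes "st_min n M s \<alpha>" "\<beta> \<in> M" "\<beta> \<noteq> 0" "s \<le> tdeg \<beta>" "min_var \<beta> < j" "j \<le> n"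
  shows "xpow j 1 + div_min \<beta> \<noteq> \<alpha>"
proof -
  have "\<forall>\<beta>\<in>M. \<beta> \<noteq> 0 \<longrightarrow> s \<le> tdeg \<beta> \<longrightarrow>
      (\<forall>j. min_var \<beta> < j \<and> j \<le> n \<longrightarrow> xpow j 1 + div_min \<beta> \<noteq> \<alpha>)"
    using assms(1) by (simp add: st_min_def)
  from this[rule_format, OF assms(2-4) conjI[OF assms(5,6)]] show ?thesis .
qed

lemma st_minimal_mspan:
  assumes "M \<subseteq> terms l n"
  shows "st_minimal l n (mspan M :: 'k::field mpoly set) s \<alpha> \<longleftrightarrow> st_min n M s \<alpha>"
  using assms unfolding st_minimal_def st_min_def graded_part_mspan monom_of_in_mspan
    monom_of_in_truncation by blast

text \<open>Terms of degree below \<open>s\<close> are given up here. This is harmless because the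
  saturation that ends \<open>Remove\<close> depends on high degrees only
  (\<open>term_sat_mono_high\<close>).\<close>

definition remove_term :: "nat \<Rightarrow> nat \<Rightarrow> nat \<Rightarrow> pterm set \<Rightarrow> pterm \<Rightarrow> pterm set" where
  "remove_term l n s X \<alpha> = term_hull l n ({\<beta> \<in> X. tdeg \<beta> = s} - {\<alpha>})"

lemma Remove_Suc_mspan:
  assumes "X \<subseteq> terms l n"
  shows "Remove (mspan X :: 'k::field mpoly set) l n s (Suc q) =
    (\<Union>\<alpha>\<in>{\<alpha>. st_min n X s \<alpha> \<and> \<alpha> \<noteq> 0 \<and> min_var \<alpha> = l}. Remove (mspan (remove_term l n s X \<alpha>)) l n s q)"
proof -
  have "Idl\<^bsub>mpoly_ring l n\<^esub> (monom_of ` ({\<beta> \<in> terms l n. monom_of \<beta> \<in> graded_part (mspan X :: 'k mpoly set) s} - {\<alpha>}))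
      = (mspan (remove_term l n s X \<alpha>) :: 'k mpoly set)" for \<alpha>
  proof -
    have "{\<beta> \<in> terms l n. monom_of \<beta> \<in> graded_part (mspan X :: 'k mpoly set) s} = {\<beta> \<in> X. tdeg \<beta> = s}"
      using assms by (auto simp: graded_part_mspan)
    then show ?thesis using assms by (simp add: remove_term_def) (rule genideal_monom_of, blast)
  qed
  then show ?thesis by (simp add: st_minimal_mspan[OF assms])
qed

context
  fixes l n s :: nat and X :: "pterm set" and \<alpha> :: pterm
  assumes X: "term_ideal l n X" and st: "stable_from s X" and \<alpha>: "st_min n X s \<alpha>" and s: "0 < s"
begin

lemma remove_term_gens: "{\<beta> \<in> X. tdeg \<beta> = s} - {\<alpha>} \<subseteq> terms l n"
  using X by (auto simp: term_ideal_def)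

lemma term_ideal_remove_term: "term_ideal l n (remove_term l n s X \<alpha>)"
  unfolding remove_term_def by (rule term_hull_ideal[OF remove_term_gens])

lemma remove_term_subset: "remove_term l n s X \<alpha> \<subseteq> X"
  unfolding remove_term_def by (rule term_hull_minimal[OF X]) auto

lemma remove_term_slice: "{\<beta> \<in> remove_term l n s X \<alpha>. tdeg \<beta> = s} = {\<beta> \<in> X. tdeg \<beta> = s} - {\<alpha>}"
proof
  show "{\<beta> \<in> X. tdeg \<beta> = s} - {\<alpha>} \<subseteq> {\<beta> \<in> remove_term l n s X \<alpha>. tdeg \<beta> = s}"
    using subset_term_hull[of "{\<beta> \<in> X. tdeg \<beta> = s} - {\<alpha>}" l n] by (auto simp: remove_term_def)
  show "{\<beta> \<in> remove_term l n s X \<alpha>. tdeg \<beta> = s} \<subseteq> {\<beta> \<in> X. tdeg \<beta> = s} - {\<alpha>}"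
  proof
    fix \<gamma> assume g: "\<gamma> \<in> {\<beta> \<in> remove_term l n s X \<alpha>. tdeg \<beta> = s}"
    then obtain \<beta> \<delta> where b: "\<beta> \<in> {\<beta> \<in> X. tdeg \<beta> = s} - {\<alpha>}" "\<gamma> = \<beta> + \<delta>"
      unfolding remove_term_def term_hull_def by blast
    then have "tdeg \<delta> = 0" using g by (simp del: tdeg_eq_0_iff)
    then show "\<gamma> \<in> {\<beta> \<in> X. tdeg \<beta> = s} - {\<alpha>}" using b by simp
  qed
qed

text \<open>Write an element as \<open>\<beta> + \<delta>\<close> with \<open>\<beta>\<close> a
  surviving generator. If its smallest variable divides \<open>\<delta>\<close>, cancel it there.
  Otherwise it divides \<open>\<beta>\<close>, and is exchanged in \<open>\<beta>\<close> for the
  smallest variable of \<open>\<delta>\<close>; the new generator is not the deleted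
  \<open>\<alpha>\<close> precisely because \<open>\<alpha>\<close> is St-minimal.\<close>

lemma stable_from_remove_term: "stable_from s (remove_term l n s X \<alpha>)"
  unfolding stable_from_def
proof (intro ballI impI)
  fix \<gamma> assume "\<gamma> \<in> remove_term l n s X \<alpha>" and deg: "s < tdeg \<gamma>"
  then obtain \<beta> \<delta> where b: "\<beta> \<in> X" "tdeg \<beta> = s" "\<beta> \<noteq> \<alpha>" "\<delta> \<in> terms l n" and g: "\<gamma> = \<beta> + \<delta>"
    by (auto simp: remove_term_def term_hull_def)
  have "\<gamma> \<noteq> 0" using deg by auto
  moreover have "\<delta> \<noteq> 0" "\<beta> \<noteq> 0" using deg b g s by auto
  ultimately have nz: "\<gamma> \<noteq> 0" "\<delta> \<noteq> 0" "\<beta> \<noteq> 0" .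
  have memI: "\<epsilon> + \<zeta> \<in> remove_term l n s X \<alpha>" if "\<epsilon> \<in> X" "tdeg \<epsilon> = s" "\<epsilon> \<noteq> \<alpha>" "\<zeta> \<in> terms l n" for \<epsilon> \<zeta>
    unfolding remove_term_def term_hull_def using that by blast
  let ?m = "min_var \<gamma>"
  show "div_min \<gamma> \<in> remove_term l n s X \<alpha>"
  proof (cases "expo \<delta> ?m = 0")
    case False
    then have "xpow ?m 1 + (\<delta> - xpow ?m 1) = \<delta>" by (rule expo_sub_xpow)
    then have "\<gamma> = xpow ?m 1 + (\<beta> + (\<delta> - xpow ?m 1))" by (metis g add.left_commute)
    then have "div_min \<gamma> = \<beta> + (\<delta> - xpow ?m 1)" by (rule div_min_eqI[OF refl])
    moreover have "\<delta> - xpow ?m 1 \<in> terms l n"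
      using b(4) by (auto simp: terms_iff lookup_minus)
    ultimately show ?thesis using memI b by simp
  next
    case True
    have "expo \<beta> ?m \<noteq> 0" using expo_min_var[OF nz(1)] True by (simp add: g lookup_add)
    then have m: "min_var \<beta> = ?m"
      by (rule min_var_eqI) (simp add: g min_var_le lookup_add)
    define j where "j = min_var \<delta>"
    have "expo \<delta> j \<noteq> 0" unfolding j_def using nz(2) by (rule expo_min_var)
    then have "?m \<le> j" "?m \<noteq> j" using True by (auto simp: g lookup_add intro!: min_var_le)
    then have j: "min_var \<beta> < j" "j \<le> n" using m min_var_terms[OF b(4) nz(2)] by (auto simp: j_def)
    have ex: "xpow j 1 + div_min \<beta> \<in> X"
      using stable_from_exchange[OF st X b(1) _ nz(3) j] b(2) by simp
    have ne: "xpow j 1 + div_min \<beta> \<noteq> \<alpha>"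
      using st_minD[OF \<alpha> b(1) nz(3) _ j] b(2) by simp
    have dg: "tdeg (xpow j 1 + div_min \<beta>) = s" using tdeg_div_min[OF nz(3)] b(2) by simp
    have "\<delta> = xpow j 1 + div_min \<delta>" using div_min_add[OF nz(2)] by (simp add: j_def)
    moreover have "\<beta> = xpow ?m 1 + div_min \<beta>" using div_min_add[OF nz(3)] by (simp only: m)
    ultimately have "\<gamma> = (xpow ?m 1 + div_min \<beta>) + (xpow j 1 + div_min \<delta>)"
      using g by simp
    then have "\<gamma> = xpow ?m 1 + ((xpow j 1 + div_min \<beta>) + div_min \<delta>)"
      by (simp only: ac_simps)
    then have "div_min \<gamma> = (xpow j 1 + div_min \<beta>) + div_min \<delta>" by (rule div_min_eqI[OF refl])
    then show ?thesis using memI[OF ex dg ne div_min_terms[OF b(4)]] by simp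
  qed
qed

lemma hilb_remove_term: "hilb l n (remove_term l n s X \<alpha>) s = Suc (hilb l n X s)"
proof -
  have "{\<beta> \<in> X - remove_term l n s X \<alpha>. tdeg \<beta> = s} = {\<beta> \<in> X. tdeg \<beta> = s} - {\<beta> \<in> remove_term l n s X \<alpha>. tdeg \<beta> = s}"
    by blast
  also have "\<dots> = {\<alpha>}" using \<alpha> by (auto simp: remove_term_slice st_min_def)
  finally show ?thesis
    using hilb_diff[OF remove_term_subset, of l n s] X by (simp add: term_ideal_def)
qed

end

section \<open>Comparing ideals through their terms of degree at least s\<close>

lemma stable_from_drop:
  assumes "stable_from s X" "\<alpha> \<noteq> 0" "s \<le> tdeg \<alpha>" "min_var \<alpha> = m"
  shows "\<alpha> + xpow m t \<in> X \<Longrightarrow> \<alpha> \<in> X"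
proof (induction t)
  case (Suc t)
  have "min_var (xpow m (Suc t) + \<alpha>) = m" using assms min_var_xpow_add by blast
  moreover have "xpow m (Suc t) + \<alpha> = xpow m 1 + (\<alpha> + xpow m t)"
    by (simp add: ac_simps flip: single_add)
  ultimately have "div_min (xpow m (Suc t) + \<alpha>) = \<alpha> + xpow m t" by (rule div_min_eqI)
  moreover have "div_min (xpow m (Suc t) + \<alpha>) \<in> X"
    using Suc.prems assms by (intro stable_fromD[OF assms(1)]) (simp_all add: add.commute)
  ultimately show ?case using Suc.IH by simp
qed simp

text \<open>Test saturation with a power of the smallest variable of \<open>\<alpha>\<close> itself:
  stability divides that power away again. \<open>0 < s\<close> ensures that such a variable
  exists.\<close>

lemma term_sat_high:
  assumes "stable_from s X" "\<alpha> \<in> term_sat l n X" "s \<le> tdeg \<alpha>" "0 < s"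
  shows "\<alpha> \<in> X"
proof -
  have nz: "\<alpha> \<noteq> 0" using assms by auto
  have "min_var \<alpha> \<in> {l..n}" using assms(2) min_var_terms[OF _ nz, of l n] by (simp add: term_sat_def)
  then obtain t where "\<alpha> + xpow (min_var \<alpha>) t \<in> X" using assms(2) unfolding term_sat_def by blast
  then show ?thesis using stable_from_drop[OF assms(1) nz assms(3) refl] by blast
qed

lemma stable_from_generated:
  assumes "stable_from s X" "term_ideal l n X"
  shows "\<gamma> \<in> X \<Longrightarrow> s \<le> tdeg \<gamma> \<Longrightarrow> \<exists>\<beta>\<in>X. \<exists>\<delta>\<in>terms l n. tdeg \<beta> = s \<and> \<gamma> = \<beta> + \<delta>"
proof (induction "tdeg \<gamma> - s" arbitrary: \<gamma>)
  case 0
  then have "tdeg \<gamma> = s" "\<gamma> = \<gamma> + 0" by simp_all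
  then show ?case using 0 zero_terms by blast
next
  case (Suc k)
  have nz: "\<gamma> \<noteq> 0" using Suc by auto
  have d: "Suc (tdeg (div_min \<gamma>)) = tdeg \<gamma>" using nz by (rule tdeg_div_min)
  have "div_min \<gamma> \<in> X" using assms(1) Suc by (intro stable_fromD) auto
  then have "\<exists>\<beta>\<in>X. \<exists>\<delta>\<in>terms l n. tdeg \<beta> = s \<and> div_min \<gamma> = \<beta> + \<delta>"
    using Suc.hyps(2) Suc.prems d by (intro Suc.hyps(1)) auto
  then obtain \<beta> \<delta> where b: "\<beta> \<in> X" "\<delta> \<in> terms l n" "tdeg \<beta> = s" "div_min \<gamma> = \<beta> + \<delta>" by blast
  have "\<gamma> = \<beta> + (xpow (min_var \<gamma>) 1 + \<delta>)" using div_min_add[OF nz] b(4) by (metis add.left_commute)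
  moreover have "\<gamma> \<in> terms l n" using assms(2) Suc.prems term_ideal_subset by blast
  then have "xpow (min_var \<gamma>) 1 + \<delta> \<in> terms l n"
    using min_var_terms[OF _ nz] b(2) by (intro add_terms xpow_terms) auto
  ultimately show ?case using b by blast
qed

text \<open>A further factor, the \<open>s\<close>-th power of x_j, moves any witness into degree at
  least \<open>s\<close>.\<close>

lemma term_sat_mono_high:
  assumes "term_ideal l n X" "\<And>\<alpha>. \<alpha> \<in> X \<Longrightarrow> s \<le> tdeg \<alpha> \<Longrightarrow> \<alpha> \<in> Y"
  shows "term_sat l n X \<subseteq> term_sat l n Y"
proof
  fix \<alpha> assume a: "\<alpha> \<in> term_sat l n X"
  have "\<exists>t. \<alpha> + xpow j t \<in> Y" if j: "j \<in> {l..n}" for j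
  proof -
    obtain t where "\<alpha> + xpow j t \<in> X" using a j unfolding term_sat_def by blast
    then have "\<alpha> + xpow j t + xpow j s \<in> X" using j term_ideal_add[OF assms(1)] xpow_terms by simp
    then have "\<alpha> + xpow j t + xpow j s \<in> Y" by (rule assms(2)) simp
    then show ?thesis by (metis add.assoc single_add)
  qed
  then show "\<alpha> \<in> term_sat l n Y" using a by (simp add: term_sat_def)
qed

text \<open>Invariant of \<open>Remove\<close> started at the cylinder over \<open>B\<close>: since
  only multiples of x_l are deleted, the degree \<open>s\<close> part of \<open>B\<close> survives.
  Later this identifies the slice of the result with \<open>B\<close> from degree \<open>s\<close>
  on.\<close>

definition cut_inv :: "nat \<Rightarrow> nat \<Rightarrow> nat \<Rightarrow> pterm set \<Rightarrow> pterm set \<Rightarrow> bool" where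
  "cut_inv l n s B X \<longleftrightarrow> term_ideal l n X \<and> stable_from s X \<and> X \<subseteq> cylinder l B \<and>
     (\<forall>\<gamma>\<in>B. tdeg \<gamma> = s \<longrightarrow> \<gamma> \<in> X)"

text \<open>Each deletion raises the Hilbert function in degree \<open>s\<close> by one, and a
  deleted term, having smallest variable x_l, cannot belong to \<open>B\<close>.\<close>

lemma Remove_sound:
  assumes B: "B \<subseteq> terms (Suc l) n" and s: "0 < s"
  shows "cut_inv l n s B X \<Longrightarrow> K \<in> Remove (mspan X :: 'k::field mpoly set) l n s q \<Longrightarrow>
    \<exists>Y. cut_inv l n s B Y \<and> K = mspan (term_sat l n Y) \<and> hilb l n Y s = hilb l n X s + q"
proof (induction q arbitrary: X)
  case 0
  then show ?case by (auto simp: saturation_mspan cut_inv_def intro!: exI[of _ X])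
next
  case (Suc q)
  have X: "term_ideal l n X" "stable_from s X" using Suc.prems by (auto simp: cut_inv_def)
  have "X \<subseteq> terms l n" using X by (simp add: term_ideal_def)
  from Suc.prems(2) obtain \<alpha> where a: "st_min n X s \<alpha>" "\<alpha> \<noteq> 0" "min_var \<alpha> = l"
    and K: "K \<in> Remove (mspan (remove_term l n s X \<alpha>) :: 'k mpoly set) l n s q"
    unfolding Remove_Suc_mspan[OF \<open>X \<subseteq> terms l n\<close>] by blast
  have "\<gamma> \<in> remove_term l n s X \<alpha>" if g: "\<gamma> \<in> B" "tdeg \<gamma> = s" for \<gamma>
  proof -
    have "\<gamma> \<in> X" using g Suc.prems(1) by (auto simp: cut_inv_def)
    moreover have "expo \<gamma> l = 0" using g B terms_Suc_iff by blast
    then have "\<gamma> \<noteq> \<alpha>" using expo_min_var[OF a(2)] a(3) by auto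
    ultimately show ?thesis using remove_term_slice[OF X a(1) s] g by blast
  qed
  then have "cut_inv l n s B (remove_term l n s X \<alpha>)"
    using Suc.prems(1) term_ideal_remove_term[OF X a(1) s] stable_from_remove_term[OF X a(1) s] remove_term_subset[OF X a(1) s]
    unfolding cut_inv_def by blast
  from Suc.IH[OF this K] show ?case using hilb_remove_term[OF X a(1) s] by simp
qed

lemma finite_slice: "term_ideal l n X \<Longrightarrow> finite {\<gamma> \<in> X. tdeg \<gamma> = s \<and> Q \<gamma>}"
  by (rule finite_subset[OF _ finite_terms_tdeg[of l n s]]) (auto simp: term_ideal_def)

text \<open>An exchange move strictly increases the weight \<open>\<Sum>i. i * expo \<alpha> i\<close>, so a term of least weight
  among those still to be removed is St-minimal.\<close>

lemma ex_st_min: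
  assumes X: "term_ideal l n X" and M: "term_ideal l n M" and st: "stable_from s M"
    and g: "\<gamma> \<in> X" "tdeg \<gamma> = s" "\<gamma> \<notin> M"
  shows "\<exists>\<alpha>. st_min n X s \<alpha> \<and> \<alpha> \<notin> M"
proof -
  define w where "w \<alpha> = (\<Sum>i\<le>n. i * expo \<alpha> i)" for \<alpha> :: pterm
  have w_add: "w (\<alpha> + \<beta>) = w \<alpha> + w \<beta>" for \<alpha> \<beta>
    by (simp add: w_def lookup_add sum.distrib distrib_left)
  have w_xpow: "w (xpow j 1) = j" if "j \<le> n" for j
  proof -
    have "w (xpow j 1) = (\<Sum>i\<le>n. if i = j then j else 0)"
      unfolding w_def by (rule sum.cong) (auto simp: lookup_single when_def)
    then show ?thesis using that by simp
  qed
  let ?Q = "\<lambda>\<alpha>. \<alpha> \<in> X \<and> tdeg \<alpha> = s \<and> \<alpha> \<notin> M"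
  obtain \<alpha> where a: "?Q \<alpha>" "\<And>\<beta>. ?Q \<beta> \<Longrightarrow> w \<alpha> \<le> w \<beta>"
    using ex_has_least_nat[of ?Q \<gamma> w] g by auto
  have "xpow j 1 + div_min \<beta> \<noteq> \<alpha>" if b: "\<beta> \<in> X" "\<beta> \<noteq> 0" "min_var \<beta> < j" "j \<le> n" for \<beta> j
  proof
    assume e: "xpow j 1 + div_min \<beta> = \<alpha>"
    have d: "tdeg \<beta> = s" using tdeg_div_min[OF b(2)] a(1) e by auto
    \<comment> \<open>Otherwise the exchange, carried out inside the stable ideal \<open>M\<close>,
      would put \<open>\<alpha>\<close> into \<open>M\<close>.\<close>
    have "\<beta> \<notin> M"
      using stable_from_exchange[OF st M _ _ b(2-4)] d e a(1) by auto
    then have "w \<alpha> \<le> w \<beta>" using a(2) b d by blast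
    moreover have "w \<beta> = min_var \<beta> + w (div_min \<beta>)"
      using w_add[of "xpow (min_var \<beta>) 1" "div_min \<beta>"] div_min_add[OF b(2)] w_xpow[of "min_var \<beta>"] b
      by simp
    moreover have "w \<alpha> = j + w (div_min \<beta>)" using w_add[of "xpow j 1" "div_min \<beta>"] e w_xpow b by simp
    ultimately show False using b by simp
  qed
  then have "st_min n X s \<alpha>" using a unfolding st_min_def by blast
  then show ?thesis using a by blast
qed

text \<open>The algorithm branches over all St-minimal terms, so one suitable order of deletions is
  enough, and \<open>ex_st_min\<close> supplies the next term. When none is left, \<open>X\<close>
  and \<open>M\<close> agree from degree \<open>s\<close> on and thus have the same
  saturation.\<close>

lemma Remove_complete:
  assumes M: "term_ideal l n M" "stable_from s M" "term_sat l n M = M" and s: "0 < s"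
  shows "term_ideal l n X \<Longrightarrow> stable_from s X \<Longrightarrow> (\<And>\<gamma>. \<gamma> \<in> M \<Longrightarrow> tdeg \<gamma> = s \<Longrightarrow> \<gamma> \<in> X) \<Longrightarrow>
    (\<And>\<gamma>. \<gamma> \<in> X \<Longrightarrow> tdeg \<gamma> = s \<Longrightarrow> \<gamma> \<notin> M \<Longrightarrow> expo \<gamma> l \<noteq> 0) \<Longrightarrow>
    card {\<gamma> \<in> X. tdeg \<gamma> = s \<and> \<gamma> \<notin> M} = q \<Longrightarrow>
    mspan M \<in> Remove (mspan X :: 'k::field mpoly set) l n s q"
proof (induction q arbitrary: X)
  case 0
  note X = 0(1,2)
  have e: "{\<gamma> \<in> X. tdeg \<gamma> = s \<and> \<gamma> \<notin> M} = {}" using 0(5) finite_slice[OF X(1)] by simp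
  have "\<gamma> \<in> M" if g: "\<gamma> \<in> X" "s \<le> tdeg \<gamma>" for \<gamma>
    using stable_from_generated[OF X(2,1) g] e term_ideal_add[OF M(1)] by blast
  then have "term_sat l n X \<subseteq> term_sat l n M" by (rule term_sat_mono_high[OF X(1)])
  moreover have "\<gamma> \<in> X" if g: "\<gamma> \<in> M" "s \<le> tdeg \<gamma>" for \<gamma>
    using stable_from_generated[OF M(2,1) g] 0(3) term_ideal_add[OF X(1)] by blast
  then have "term_sat l n M \<subseteq> term_sat l n X" by (rule term_sat_mono_high[OF M(1)])
  ultimately have "term_sat l n X = M" using M(3) by simp
  then show ?case using X by (simp add: saturation_mspan)
next
  case (Suc q)
  note X = Suc.prems(1,2)
  let ?S = "\<lambda>X. {\<gamma> \<in> X. tdeg \<gamma> = s \<and> \<gamma> \<notin> M}"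
  have "?S X \<noteq> {}" using Suc.prems(5) by (metis card.empty nat.distinct(1))
  then obtain \<alpha> where a: "st_min n X s \<alpha>" "\<alpha> \<notin> M" using ex_st_min[OF X(1) M(1,2)] by blast
  have aX: "\<alpha> \<in> X" "tdeg \<alpha> = s" using a by (auto simp: st_min_def)
  then have nz: "\<alpha> \<noteq> 0" using s by auto
  have Xt: "X \<subseteq> terms l n" using X by (simp add: term_ideal_def)
  have min: "min_var \<alpha> = l" using aX Xt Suc.prems(4)[OF aX a(2)] by (intro min_var_eq_low) auto
  note slice = remove_term_slice[OF X a(1) s]
  have "mspan M \<in> Remove (mspan (remove_term l n s X \<alpha>) :: 'k mpoly set) l n s q"
  proof (rule Suc.IH)
    show "term_ideal l n (remove_term l n s X \<alpha>)" by (rule term_ideal_remove_term[OF X a(1) s])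
    show "stable_from s (remove_term l n s X \<alpha>)" by (rule stable_from_remove_term[OF X a(1) s])
    show "\<gamma> \<in> remove_term l n s X \<alpha>" if "\<gamma> \<in> M" "tdeg \<gamma> = s" for \<gamma>
      using that Suc.prems(3)[OF that] a(2) slice by blast
    show "expo \<gamma> l \<noteq> 0" if "\<gamma> \<in> remove_term l n s X \<alpha>" "tdeg \<gamma> = s" "\<gamma> \<notin> M" for \<gamma>
      using that slice Suc.prems(4) by blast
    have "?S (remove_term l n s X \<alpha>) = ?S X - {\<alpha>}" using slice by blast
    then show "card (?S (remove_term l n s X \<alpha>)) = q"
      using Suc.prems(5) aX a(2) by simp
  qed
  then show ?case unfolding Remove_Suc_mspan[OF Xt] using a nz min by blast
qed

section \<open>Hilbert functions of saturated quasi-stable ideals and of their slices\<close>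

definition sat_qstable :: "nat \<Rightarrow> nat \<Rightarrow> nat list \<Rightarrow> pterm set set" where
  "sat_qstable l n a = {M. qstable l n M \<and> term_sat l n M = M \<and>
     (\<forall>\<^sub>F t in sequentially. hilb l n M t = gotz a t)}"

lemma hilb_cong:
  "(\<And>\<alpha>. \<alpha> \<in> terms l n \<Longrightarrow> tdeg \<alpha> = t \<Longrightarrow> \<alpha> \<in> M \<longleftrightarrow> \<alpha> \<in> N) \<Longrightarrow> hilb l n M t = hilb l n N t"
  unfolding hilb_def by (rule arg_cong[of _ _ card]) blast

lemma hilb_Suc:
  assumes "qstable l n M" "term_sat l n M = M" "l \<le> n"
  shows "hilb l n M (Suc t) = hilb l n M t + hilb (Suc l) n (M \<inter> terms (Suc l) n) (Suc t)"
proof -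
  have M: "M = cylinder l (M \<inter> terms (Suc l) n)"
    using assms by (intro term_sat_cylinder qstable_ideal)
  have "hilb l n M t = (\<Sum>j\<le>t. hilb (Suc l) n (M \<inter> terms (Suc l) n) j)" for t
    by (subst M) (rule hilb_cylinder, use assms in auto)
  then show ?thesis by simp
qed

text \<open>From degree \<open>length a - 1\<close> on all zeros of \<open>a\<close> are visible, so
  their number \<open>m\<close> cancels in the difference.\<close>

lemma gotz_Suc:
  assumes "a = map Suc b @ replicate m 0" "length a \<le> Suc t"
  shows "gotz a (Suc t) = gotz a t + gotz b (Suc t)"
  using assms by (simp add: gotz_integrate)

text \<open>The deletions guarantee only the value in degree \<open>s\<close>. The slice of the
  saturation agrees with \<open>B\<close> from degree \<open>s\<close> on, because \<open>B\<close>
  is generated there by its degree \<open>s\<close> part. Hence the consecutive differences are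
  those of \<open>gotz a\<close>, and equality spreads upwards from \<open>s\<close>.\<close>

lemma sat_qstable_of_cut:
  assumes ln: "l \<le> n" and s: "0 < s" and a: "a = map Suc b @ replicate m 0" "length a \<le> s"
    and b: "sorted_wrt (\<ge>) b" and B: "B \<in> sat_qstable (Suc l) n b"
    and Y: "cut_inv l n s B Y" and h: "hilb l n Y s = gotz a s"
  shows "term_sat l n Y \<in> sat_qstable l n a"
proof -
  have Yi: "term_ideal l n Y" and Ys: "stable_from s Y" and YB: "Y \<subseteq> cylinder l B"
    and BY: "\<And>\<gamma>. \<gamma> \<in> B \<Longrightarrow> tdeg \<gamma> = s \<Longrightarrow> \<gamma> \<in> Y"
    using Y by (auto simp: cut_inv_def)
  have Bq: "qstable (Suc l) n B" and reg: "stable_from (length b) B"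
    "\<And>t. length b \<le> t \<Longrightarrow> hilb (Suc l) n B t = gotz b t"
    using B gotzmann_regularity[OF _ _ b, of "Suc l" n B] by (auto simp: sat_qstable_def)
  have Bi: "term_ideal (Suc l) n B" using Bq by (rule qstable_ideal)
  then have Bt: "B \<subseteq> terms (Suc l) n" by (simp add: term_ideal_def)
  have bs: "length b \<le> s" using a by simp
  have Bs: "stable_from s B" using reg(1) bs by (rule stable_from_mono)
  define M where "M = term_sat l n Y"
  have Yq: "qstable l n Y" using Ys Yi by (rule stable_from_qstable)
  have Mq: "qstable l n M" unfolding M_def using Yq by (rule qstable_term_sat)
  have Msat: "term_sat l n M = M" unfolding M_def using Yi by (rule term_sat_idem)
  have YM: "Y \<subseteq> M" unfolding M_def using Yi by (rule term_sat_subset)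
  \<comment> \<open>The saturation can be tested with a power of x_l, which stripping
    ignores.\<close>
  have MB: "strip l \<alpha> \<in> B" if "\<alpha> \<in> M" for \<alpha>
  proof -
    have "\<forall>j\<in>{l..n}. \<exists>t. \<alpha> + xpow j t \<in> Y" using that by (simp add: M_def term_sat_def)
    from bspec[OF this, of l] ln obtain t where "\<alpha> + xpow l t \<in> Y" by auto
    then have "strip l (\<alpha> + xpow l t) \<in> B" using YB cylinder_iff[OF Bt] by blast
    moreover have "strip l (\<alpha> + xpow l t) = strip l \<alpha>"
      by (rule poly_mapping_eqI) (auto simp: strip_def lookup_minus lookup_add lookup_single when_def)
    ultimately show ?thesis by simp
  qed
  have "hilb (Suc l) n (M \<inter> terms (Suc l) n) t = hilb (Suc l) n B t" if t: "s \<le> t" for t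
  proof (rule hilb_cong, rule iffI)
    fix \<alpha> assume \<alpha>: "\<alpha> \<in> terms (Suc l) n" "tdeg \<alpha> = t"
    show "\<alpha> \<in> B" if "\<alpha> \<in> M \<inter> terms (Suc l) n"
      using MB[of \<alpha>] that strip_id[OF \<alpha>(1)] by simp
    assume "\<alpha> \<in> B"
    then obtain \<beta> \<delta> where "\<beta> \<in> B" "\<delta> \<in> terms (Suc l) n" "tdeg \<beta> = s" "\<alpha> = \<beta> + \<delta>"
      using stable_from_generated[OF Bs Bi, of \<alpha>] \<alpha> t by blast
    then have "\<alpha> \<in> Y" using BY term_ideal_add[OF Yi] terms_mono by blast
    then show "\<alpha> \<in> M \<inter> terms (Suc l) n" using YM \<alpha> by blast
  qed
  then have step: "hilb l n M (Suc t) = hilb l n M t + gotz b (Suc t)" if "s \<le> t" for t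
    using hilb_Suc[OF Mq Msat ln] reg(2) bs that by simp
  have "hilb l n M t = gotz a t" if "s \<le> t" for t
    using that
  proof (induction t rule: dec_induct)
    case base
    have "hilb l n M s = hilb l n Y s"
      using YM term_sat_high[OF Ys _ _ s] by (intro hilb_cong) (auto simp: M_def)
    then show ?case using h by simp
  next
    case (step t)
    then show ?case using gotz_Suc[OF a(1), of t] a(2) \<open>\<And>t. s \<le> t \<Longrightarrow> hilb l n M (Suc t) = _ t\<close> by simp
  qed
  then have "\<forall>\<^sub>F t in sequentially. hilb l n M t = gotz a t"
    unfolding eventually_sequentially by blast
  then show ?thesis using Mq Msat by (simp add: sat_qstable_def flip: M_def)
qed

text \<open>Finds the ideal of the recursive call from which \<open>M\<close> is cut. By stability
  the slice and its saturation \<open>B\<close> agree from degree \<open>s\<close> on, so above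
  \<open>s\<close> the Hilbert function of \<open>B\<close> is the difference of that of
  \<open>M\<close>.\<close>

lemma sat_qstable_restrict:
  assumes ln: "l \<le> n" and s: "0 < s" and a: "a = map Suc b @ replicate m 0" "length a \<le> s"
    and sa: "sorted_wrt (\<ge>) a" and M: "M \<in> sat_qstable l n a"
  defines "B \<equiv> term_sat (Suc l) n (M \<inter> terms (Suc l) n)"
  shows "B \<in> sat_qstable (Suc l) n b" and "M \<subseteq> cylinder l B"
    and "\<And>\<gamma>. \<gamma> \<in> B \<Longrightarrow> tdeg \<gamma> = s \<Longrightarrow> \<gamma> \<in> M"
proof -
  define N where "N = M \<inter> terms (Suc l) n"
  have Mq: "qstable l n M" and Msat: "term_sat l n M = M" and reg: "stable_from (length a) M"
    "\<And>t. length a \<le> t \<Longrightarrow> hilb l n M t = gotz a t"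
    using M gotzmann_regularity[OF _ _ sa, of l n M] by (auto simp: sat_qstable_def)
  have Mi: "term_ideal l n M" using Mq by (rule qstable_ideal)
  have Ms: "stable_from s M" using reg(1) a(2) by (rule stable_from_mono)
  then have Ns: "stable_from s N" by (auto simp: stable_from_def N_def div_min_terms)
  have Nq: "qstable (Suc l) n N" unfolding N_def using Mq by (rule qstable_restrict)
  then have Ni: "term_ideal (Suc l) n N" by (rule qstable_ideal)
  have NB: "N \<subseteq> B" unfolding B_def N_def[symmetric] using Ni by (rule term_sat_subset)
  have BN: "\<gamma> \<in> N" if "\<gamma> \<in> B" "s \<le> tdeg \<gamma>" for \<gamma>
    using term_sat_high[OF Ns _ _ s] that unfolding B_def N_def[symmetric] by blast
  then show "\<And>\<gamma>. \<gamma> \<in> B \<Longrightarrow> tdeg \<gamma> = s \<Longrightarrow> \<gamma> \<in> M" by (auto simp: N_def)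
  have "M = cylinder l N" unfolding N_def by (rule term_sat_cylinder[OF Mi Msat Mq ln])
  then show "M \<subseteq> cylinder l B" using NB by (auto simp: cylinder_def)
  have "hilb (Suc l) n B (Suc t) = gotz b (Suc t)" if "s \<le> t" for t
  proof -
    have "hilb (Suc l) n B (Suc t) = hilb (Suc l) n N (Suc t)"
      using NB BN that by (intro hilb_cong) auto
    then show ?thesis
      using hilb_Suc[OF Mq Msat ln, of t] gotz_Suc[OF a(1), of t] reg(2)[of t] reg(2)[of "Suc t"] a(2) that
      by (simp add: N_def)
  qed
  then have "hilb (Suc l) n B t = gotz b t" if "Suc s \<le> t" for t using that by (cases t) auto
  then have "\<forall>\<^sub>F t in sequentially. hilb (Suc l) n B t = gotz b t"
    unfolding eventually_sequentially by blast
  moreover have "qstable (Suc l) n B" unfolding B_def N_def[symmetric] using Nq by (rule qstable_term_sat)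
  moreover have "term_sat (Suc l) n B = B" unfolding B_def N_def[symmetric] using Ni by (rule term_sat_idem)
  ultimately show "B \<in> sat_qstable (Suc l) n b" by (simp add: sat_qstable_def)
qed

section \<open>Correctness of the algorithm\<close>

primrec gotz_poly :: "nat list \<Rightarrow> rat \<Rightarrow> rat" where
  "gotz_poly [] z = 0"
| "gotz_poly (x # a) z = ((z + of_nat x) gchoose x) + gotz_poly a (z - 1)"

lemma gotz_poly_eq_sum:
  "gotz_poly a z = (\<Sum>i<length a. (z + rat_of_nat (a ! i) - rat_of_nat i) gchoose (a ! i))"
  by (induction a arbitrary: z)
    (simp_all add: sum.lessThan_Suc_shift algebra_simps del: sum.lessThan_Suc)

text \<open>The truncation in \<open>gotz\<close> drops the positions above \<open>t\<close>, and a
  list of length at most \<open>Suc t\<close> has none.\<close>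

lemma gotz_poly_of_nat: "length a \<le> Suc t \<Longrightarrow> gotz_poly a (of_nat t) = of_nat (gotz a t)"
proof (induction a arbitrary: t)
  case (Cons x a)
  have *: "(rat_of_nat t + rat_of_nat x) gchoose x = of_nat ((t + x) choose x)"
    by (simp add: binomial_gbinomial)
  show ?case
  proof (cases t)
    case 0
    then show ?thesis using Cons.prems * by simp
  next
    case (Suc u)
    then show ?thesis using Cons * by simp
  qed
qed simp

text \<open>Pascal's rule lowers each positive exponent by one, and the constants cancel.\<close>

lemma gotz_poly_diff:
  "gotz_poly (map Suc b @ replicate m 0) z - gotz_poly (map Suc b @ replicate m 0) (z - 1) = gotz_poly b z"
proof (induction b arbitrary: z)
  case Nil
  have "gotz_poly (replicate m 0) z = of_nat m" for z by (induction m arbitrary: z) simp_all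
  then show ?case by simp
next
  case (Cons x b)
  have "(z + of_nat (Suc x)) gchoose Suc x = ((z + of_nat x) gchoose x) + ((z + of_nat x) gchoose Suc x)"
    using gbinomial_Suc_Suc[of "z + of_nat x" x] by (simp add: ac_simps)
  then show ?case using Cons[of "z - 1"] by (simp add: algebra_simps)
qed

lemma poly_backward_diff: "poly (backward_diff P) z = poly P z - poly P (z - 1)"
  by (simp add: backward_diff_def poly_pcompose)

lemma gotz_poly_zero_iff:
  assumes "\<And>z. poly P z = gotz_poly a z"
  shows "P = 0 \<longleftrightarrow> a = []"
proof
  assume "P = 0"
  then have "of_nat (gotz a (length a)) = (0 :: rat)"
    using assms[of "of_nat (length a)"] gotz_poly_of_nat[of a "length a"] by simp
  then show "a = []" using gotz_pos[of a "length a"] by (metis less_irrefl of_nat_eq_0_iff)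
next
  assume "a = []"
  then show "P = 0" using assms by (simp add: poly_eq_poly_eq_iff[symmetric] fun_eq_iff)
qed

section \<open>From ideals with given Hilbert polynomial to sets of terms\<close>

lemma hilb_add_card:
  assumes "M \<subseteq> terms l n"
  shows "hilb l n M t + card {\<alpha> \<in> M. tdeg \<alpha> = t} = card {\<alpha> \<in> terms l n. tdeg \<alpha> = t}"
  using hilb_diff[of "{}" M l n t] assms by (simp add: hilb_def)

lemma has_hilbert_polynomial_iff:
  assumes P: "\<And>z. poly P z = gotz_poly a z" and M: "M \<subseteq> terms l n"
  shows "has_hilbert_polynomial l n (mspan M :: 'k::field mpoly set) P \<longleftrightarrow>
    (\<forall>\<^sub>F t in sequentially. hilb l n M t = gotz a t)"
  unfolding has_hilbert_polynomial_def
proof (rule eventually_cong)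
  show "\<forall>\<^sub>F t in sequentially. length a \<le> t" by (rule eventually_ge_at_top)
  fix t assume t: "length a \<le> t"
  let ?S = "card {\<alpha> \<in> terms l n. tdeg \<alpha> = t}" and ?M = "card {\<alpha> \<in> M. tdeg \<alpha> = t}"
  have "rat_of_nat ?S - rat_of_nat ?M = rat_of_nat (hilb l n M t)"
    using arg_cong[OF hilb_add_card[OF M, of t], of rat_of_nat] by simp
  moreover have "poly P (rat_of_nat t) = rat_of_nat (gotz a t)"
    using P gotz_poly_of_nat[of a t] t by simp
  ultimately show "(rat_of_nat (poly_vs.dim (graded_part (carrier (mpoly_ring l n) :: 'k mpoly set) t))
      - rat_of_nat (poly_vs.dim (graded_part (mspan M :: 'k mpoly set) t)) = poly P (rat_of_nat t)) \<longleftrightarrow>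
      hilb l n M t = gotz a t"
    using M by (simp add: dim_graded_part[of _ l n])
qed

lemma sat_qstable_ideals:
  assumes P: "\<And>z. poly P z = gotz_poly a z"
  shows "{J :: 'k::field mpoly set. quasi_stable l n J \<and> saturated l n J \<and> has_hilbert_polynomial l n J P}
    = mspan ` sat_qstable l n a"
proof -
  have "qstable l n M \<Longrightarrow> M \<subseteq> terms l n" for M by (simp add: qstable_def term_ideal_def)
  then show ?thesis
    by (auto simp: quasi_stable_iff sat_qstable_def saturated_mspan_iff[OF qstable_ideal]
        has_hilbert_polynomial_iff[OF P])
qed

text \<open>The case \<open>P = 0\<close> of the algorithm. For the empty list the regularity bound
  makes the Hilbert function vanish in every degree, so no term can be missing.\<close>

lemma sat_qstable_Nil: "sat_qstable l n [] = {terms l n}"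
proof -
  have "stable_from 0 (terms l n)" by (simp add: stable_from_def div_min_terms)
  then have "qstable l n (terms l n)" by (rule stable_from_qstable) (rule term_ideal_terms)
  moreover have "term_sat l n (terms l n) = terms l n"
    using term_sat_subset[OF term_ideal_terms, of l n] by (auto simp: term_sat_def)
  ultimately have "terms l n \<in> sat_qstable l n []" by (simp add: sat_qstable_def hilb_eq_0)
  moreover have "M = terms l n" if M: "M \<in> sat_qstable l n []" for M
  proof (rule ccontr)
    have q: "qstable l n M" and z: "\<And>t. hilb l n M t = 0"
      using gotzmann_regularity[of l n M "[]"] M by (auto simp: sat_qstable_def)
    assume "M \<noteq> terms l n"
    then obtain \<alpha> where a: "\<alpha> \<in> terms l n - M"
      using term_ideal_subset[OF qstable_ideal[OF q]] by blast
    have "finite {\<beta> \<in> terms l n - M. tdeg \<beta> = tdeg \<alpha>}"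
      by (rule finite_subset[OF _ finite_terms_tdeg[of l n "tdeg \<alpha>"]]) auto
    then have "{\<beta> \<in> terms l n - M. tdeg \<beta> = tdeg \<alpha>} = {}" using z[of "tdeg \<alpha>"] by (simp add: hilb_def)
    then show False using a by blast
  qed
  ultimately show ?thesis by blast
qed

text \<open>\<open>QuasiStable_eq\<close> ranges over all \<open>l\<close>, so rings without
  variables occur in its induction. There a nonempty list admits no ideal, and by
  \<open>Remove_trivial\<close> the algorithm finds none, as there is no term of positive degree to
  delete.\<close>

lemma sat_qstable_trivial:
  assumes "n < l" "a \<noteq> []" shows "sat_qstable l n a = {}"
proof -
  have "M \<notin> sat_qstable l n a" for M
  proof
    assume M: "M \<in> sat_qstable l n a"
    have t: "terms l n = {0}" using assms by (simp add: terms_trivial)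
    have "M = {0}" using M assms(1) by (auto simp: sat_qstable_def term_sat_def t)
    then have "\<And>t. hilb l n M t \<noteq> gotz a t" using gotz_pos[OF assms(2)] t by (simp add: hilb_eq_0)
    then show False using M by (simp add: sat_qstable_def)
  qed
  then show ?thesis by blast
qed

lemma Remove_trivial:
  assumes "n < l" "0 < s" "X \<subseteq> terms l n"
  shows "Remove (mspan X :: 'k::field mpoly set) l n s (Suc q) = {}"
proof -
  have "\<not> st_min n X s \<alpha>" for \<alpha> using assms by (auto simp: terms_trivial st_min_def)
  then show ?thesis by (simp only: Remove_Suc_mspan[OF assms(3)]) simp
qed

lemma term_hull_cylinder:
  assumes B: "term_ideal (Suc l) n B" and ln: "l \<le> n"
  shows "term_hull l n B = cylinder l B"
proof
  have "B \<subseteq> terms (Suc l) n" using B by (simp add: term_ideal_def)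
  then have "B \<subseteq> cylinder l B" by (auto simp: cylinder_iff strip_id subset_iff)
  then show "term_hull l n B \<subseteq> cylinder l B"
    by (rule term_hull_minimal[OF term_ideal_cylinder[OF B ln]])
  show "cylinder l B \<subseteq> term_hull l n B"
    unfolding cylinder_def term_hull_def using xpow_terms[OF order_refl ln] by blast
qed

text \<open>One level of the recursion. Every output has the required Hilbert function whichever
  \<open>B\<close> it came from, and every \<open>M\<close> is found at the \<open>B\<close>
  obtained by saturating its slice.\<close>

lemma Remove_cylinder:
  assumes ln: "l \<le> n" and s: "0 < s" and a: "a = map Suc b @ replicate m 0" "length a \<le> s"
    and sa: "sorted_wrt (\<ge>) a" and b: "sorted_wrt (\<ge>) b"
  shows "(\<Union>B\<in>sat_qstable (Suc l) n b. if hilb l n (cylinder l B) s \<le> gotz a s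
      then Remove (mspan (cylinder l B) :: 'k::field mpoly set) l n s (gotz a s - hilb l n (cylinder l B) s)
      else {}) = mspan ` sat_qstable l n a" (is "?L = ?R")
proof (intro subset_antisym subsetI)
  have cyl: "term_ideal l n (cylinder l B)" "stable_from s (cylinder l B)" "B \<subseteq> terms (Suc l) n"
    if B: "B \<in> sat_qstable (Suc l) n b" for B
  proof -
    have Bi: "term_ideal (Suc l) n B" using B by (auto simp: sat_qstable_def intro: qstable_ideal)
    then show t: "B \<subseteq> terms (Suc l) n" by (simp add: term_ideal_def)
    show "term_ideal l n (cylinder l B)" using Bi ln by (rule term_ideal_cylinder)
    have "stable_from (length b) B"
      using B gotzmann_regularity[OF _ _ b, of "Suc l" n B] by (auto simp: sat_qstable_def)
    then have "stable_from s B" using a by (auto intro: stable_from_mono)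
    then show "stable_from s (cylinder l B)"
      by (intro stable_from_cylinder[OF t ln]) (auto dest: stable_fromD)
  qed
  {
    fix K assume "K \<in> ?L"
    then obtain B where B: "B \<in> sat_qstable (Suc l) n b" and le: "hilb l n (cylinder l B) s \<le> gotz a s"
      and K: "K \<in> Remove (mspan (cylinder l B)) l n s (gotz a s - hilb l n (cylinder l B) s)"
      by (auto split: if_splits)
    have "cut_inv l n s B (cylinder l B)"
      using cyl[OF B] by (auto simp: cut_inv_def cylinder_iff strip_id)
    from Remove_sound[OF cyl(3)[OF B] s this K] le
    obtain Y where "cut_inv l n s B Y" "K = mspan (term_sat l n Y)" "hilb l n Y s = gotz a s" by auto
    then show "K \<in> ?R" using sat_qstable_of_cut[OF ln s a b B] by blast
  }
  {
    fix K assume "K \<in> ?R"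
    then obtain M where M: "M \<in> sat_qstable l n a" and K: "K = mspan M" by blast
    have Mi: "term_ideal l n M" "term_sat l n M = M" "stable_from s M" "hilb l n M s = gotz a s"
      using M a gotzmann_regularity[OF _ _ sa, of l n M]
      by (auto simp: sat_qstable_def intro: qstable_ideal stable_from_mono)
    obtain B where B: "B \<in> sat_qstable (Suc l) n b" "M \<subseteq> cylinder l B"
      "\<And>\<gamma>. \<gamma> \<in> B \<Longrightarrow> tdeg \<gamma> = s \<Longrightarrow> \<gamma> \<in> M"
      using sat_qstable_restrict[OF ln s a sa M] by blast
    note C = cyl[OF B(1)]
    have "cylinder l B \<subseteq> terms l n" using C(1) by (simp add: term_ideal_def)
    \<comment> \<open>The number of terms to delete is the difference of the two Hilbert functions;
      in particular the test in the algorithm succeeds.\<close>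
    then have h: "gotz a s = hilb l n (cylinder l B) s + card {\<gamma> \<in> cylinder l B. tdeg \<gamma> = s \<and> \<gamma> \<notin> M}"
      using hilb_diff[OF B(2), of l n s] Mi(4) by (simp add: conj_ac)
    have "mspan M \<in> Remove (mspan (cylinder l B) :: 'k mpoly set) l n s (gotz a s - hilb l n (cylinder l B) s)"
    proof (rule Remove_complete[OF Mi(1,3,2) s C(1,2)])
      show "\<gamma> \<in> cylinder l B" if "\<gamma> \<in> M" for \<gamma> using that B(2) by blast
      \<comment> \<open>A term of the cylinder free of x_l belongs to \<open>B\<close>, whose degree
        \<open>s\<close> part lies in \<open>M\<close>; so everything to be deleted is divisible by
        x_l.\<close>
      show "expo \<gamma> l \<noteq> 0" if "\<gamma> \<in> cylinder l B" "tdeg \<gamma> = s" "\<gamma> \<notin> M" for \<gamma>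
      proof
        assume "expo \<gamma> l = 0"
        then have "strip l \<gamma> = \<gamma>" using strip_add[of l \<gamma>] by simp
        then have "\<gamma> \<in> B" using that(1) C(3) by (simp add: cylinder_iff)
        then show False using B(3) that by blast
      qed
      show "card {\<gamma> \<in> cylinder l B. tdeg \<gamma> = s \<and> \<gamma> \<notin> M} = gotz a s - hilb l n (cylinder l B) s"
        using h by simp
    qed
    then show "K \<in> ?L" using h K by (intro UN_I[OF B(1)]) simp
  }
qed

text \<open>Induction along the recursion with the exponent list left free: the recursive call works
  with \<open>b\<close>, which is no longer than \<open>a\<close>, so the same \<open>s\<close>
  remains large enough.\<close>

lemma QuasiStable_eq:
  assumes "\<And>z. poly P z = gotz_poly a z" "sorted_wrt (\<ge>) a" "length a \<le> s" "0 < s"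
  shows "(QuasiStable l n P s :: 'k::field mpoly set set) = mspan ` sat_qstable l n a"
  using assms
proof (induction l n P s arbitrary: a rule: QuasiStable.induct)
  case (1 l n P s)
  note P = 1(2) and sa = 1(3) and as = 1(4) and s = 1(5)
  show ?case
  proof (cases "P = 0")
    case True
    then have "a = []" using gotz_poly_zero_iff[OF P] by simp
    then show ?thesis
      using True by (subst QuasiStable.simps) (simp add: genideal_one sat_qstable_Nil)
  next
    case False
    then have ne: "a \<noteq> []" using gotz_poly_zero_iff[OF P] by simp
    obtain b m where a: "a = map Suc b @ replicate m 0" and b: "sorted_wrt (\<ge>) b"
      using sorted_desc_split[OF sa] by blast
    have "poly (backward_diff P) z = gotz_poly b z" for z
      using P gotz_poly_diff[of b m z] by (simp add: poly_backward_diff a)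
    then have IH: "(QuasiStable (Suc l) n (backward_diff P) s :: 'k mpoly set set) = mspan ` sat_qstable (Suc l) n b"
      using 1(1)[OF False, of b] b s as a by simp
    \<comment> \<open>The hull is kept until the case distinction: for \<open>l > n\<close> a
      cylinder would leave the ring, since x_l is not among its variables.\<close>
    define q where "q B = poly P (rat_of_nat s) - rat_of_nat ((n + s - l) choose s)
      + rat_of_nat (poly_vs.dim (graded_part (mspan (term_hull l n B) :: 'k mpoly set) s))" for B
    have Ps: "poly P (rat_of_nat s) = rat_of_nat (gotz a s)"
      using P gotz_poly_of_nat[of a s] as by simp
    have Bt: "term_ideal (Suc l) n B" if "B \<in> sat_qstable (Suc l) n b" for B
      using that by (auto simp: sat_qstable_def intro: qstable_ideal)
    have hull: "term_hull l n B \<subseteq> terms l n" "Idl\<^bsub>mpoly_ring l n\<^esub> (mspan B) = (mspan (term_hull l n B) :: 'k mpoly set)"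
      if "B \<in> sat_qstable (Suc l) n b" for B
    proof -
      have "B \<subseteq> terms l n" using Bt[OF that] by (auto simp: term_ideal_def terms_mono)
      then show "term_hull l n B \<subseteq> terms l n" "Idl\<^bsub>mpoly_ring l n\<^esub> (mspan B) = (mspan (term_hull l n B) :: 'k mpoly set)"
        using term_hull_ideal[of B l n] by (simp add: term_ideal_def, intro genideal_mspan)
    qed
    \<comment> \<open>The binomial minus the dimension is the Hilbert function in degree
      \<open>s\<close>. So \<open>q B\<close> is a difference of natural numbers, its sign is
      decided by comparing them, and the floor changes nothing.\<close>
    have q: "q B = rat_of_nat (gotz a s) - rat_of_nat (hilb l n (term_hull l n B) s)"
      if "B \<in> sat_qstable (Suc l) n b" for B
      using arg_cong[OF hilb_add_card[OF hull(1)[OF that], of s], of rat_of_nat]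
      by (simp add: q_def Ps dim_graded_part[OF hull(1)[OF that]] card_terms[OF s])
    have QS: "(QuasiStable l n P s :: 'k mpoly set set) = (\<Union>B\<in>sat_qstable (Suc l) n b.
        if q B \<ge> 0 then Remove (mspan (term_hull l n B)) l n s (nat \<lfloor>q B\<rfloor>) else {})"
      unfolding QuasiStable.simps[of l n P s] IH image_image if_not_P[OF False]
      by (rule SUP_cong[OF refl]) (simp only: Let_def q_def hull(2))
    also have "\<dots> = (\<Union>B\<in>sat_qstable (Suc l) n b. if hilb l n (term_hull l n B) s \<le> gotz a s
        then Remove (mspan (term_hull l n B)) l n s (gotz a s - hilb l n (term_hull l n B) s) else {})"
    proof (rule SUP_cong[OF refl])
      fix B assume B: "B \<in> sat_qstable (Suc l) n b"
      have "nat \<lfloor>q B\<rfloor> = gotz a s - hilb l n (term_hull l n B) s"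
        if "hilb l n (term_hull l n B) s \<le> gotz a s"
        using q[OF B] that by (simp flip: of_nat_diff)
      then show "(if q B \<ge> 0 then Remove (mspan (term_hull l n B) :: 'k mpoly set) l n s (nat \<lfloor>q B\<rfloor>) else {}) =
        (if hilb l n (term_hull l n B) s \<le> gotz a s
         then Remove (mspan (term_hull l n B)) l n s (gotz a s - hilb l n (term_hull l n B) s) else {})"
        using q[OF B] by simp
    qed
    also have "\<dots> = mspan ` sat_qstable l n a"
    proof (cases "l \<le> n")
      case True
      show ?thesis
        using Remove_cylinder[OF True s a as sa b, where 'k = 'k] term_hull_cylinder[OF Bt True]
        by (simp cong: SUP_cong if_cong)
    next
      case False
      have "hilb l n (term_hull l n B) s = 0" if "B \<in> sat_qstable (Suc l) n b" for B
        using False s by (simp add: hilb_def terms_trivial)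
      moreover obtain k where "gotz a s = Suc k" using gotz_pos[OF ne, of s] gr0_implies_Suc by blast
      ultimately show ?thesis
        using False s hull(1) by (simp add: sat_qstable_trivial[OF _ ne] Remove_trivial del: Remove.simps)
    qed
    finally show ?thesis .
  qed
qed

theorem theorem6p2:
  fixes l n s r :: nat and P :: "rat poly"
  assumes "l < n"
    and "admissible TYPE('k::field) l n P"
    and "is_gotzmann_number P r"
    and "0 < s" and "r \<le> s"
  shows "(QuasiStable l n P s :: 'k mpoly set set) =
    {J. quasi_stable l n J \<and> saturated l n J \<and> has_hilbert_polynomial l n J P}"
proof -
  obtain a where a: "length a = r" "sorted_wrt (\<ge>) a" and "\<And>z. poly P z = gotz_poly a z"
    using assms(3) unfolding is_gotzmann_number_def by (auto simp: gotz_poly_eq_sum)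
  then show ?thesis
    using QuasiStable_eq[where 'k = 'k, of P a s l n] sat_qstable_ideals[where 'k = 'k, of P a l n] assms
    by simp
qed

end
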